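(* (Marsden identity) Let $\Delta=[\boldsymbol p_1,\boldsymbol p_2,\boldsymbol p_3]\subset\mathbb R^2$ be a nondegenerate triangle with Powell–Sabin 12-split, with simplex spline bases $\boldsymbol s_d=[S_{1,d},\dots,S_{n_d,d}]^{\mathrm T}$ and dual polynomials $\boldsymbol\psi_d=[\Psi_{1,d},\dots,\Psi_{n_d,d}]^{\mathrm T}$ as defined in the context. Then for all $\boldsymbol x\in\Delta$ and $\boldsymbol y\in\mathbb R^2$ $$(1-\boldsymbol x^{\mathrm T}\boldsymbol y)^d=\sum_{j=1}^{n_d}S_{j,d}(\boldsymbol x)\Psi_{j,d}(\boldsymbol y)=\boldsymbol s_d(\boldsymbol x)^{\mathrm T}\boldsymbol\psi_d(\boldsymbol y),\qquad d=0,1,2,3.$$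
   Context: **The 12-split.** $\boldsymbol p_4=\frac{\boldsymbol p_1+\boldsymbol p_2}2$, $\boldsymbol p_5=\frac{\boldsymbol p_2+\boldsymbol p_3}2$, $\boldsymbol p_6=\frac{\boldsymbol p_3+\boldsymbol p_1}2$, $\boldsymbol p_7=\frac{\boldsymbol p_4+\boldsymbol p_6}2$, $\boldsymbol p_8=\frac{\boldsymbol p_4+\boldsymbol p_5}2$, $\boldsymbol p_9=\frac{\boldsymbol p_5+\boldsymbol p_6}2$, $\boldsymbol p_{10}=\frac{\boldsymbol p_1+\boldsymbol p_2+\boldsymbol p_3}3$. The subtriangles (by vertex indices), in order $k=1,\dots,12$, are $[1,6,7],[1,4,7],[2,4,8],[2,5,8],[3,5,9],[3,6,9],[6,7,10],[4,7,10],[4,8,10],[5,8,10],[5,9,10],[6,9,10]$. They are taken half-open: every point of $\Delta$ is assigned to exactly one subtriangle $\Delta_k$ containing it, so $\Delta=\bigsqcup_k\Delta_k$. **Simplex splines.** For a multiset $\mathcal K=\{\boldsymbol k_1,\dots,\boldsymbol k_{d+3}\}$ of points $\boldsymbol p_i$, not all on one line, $d\ge1$, choose a simplex $\sigma=[\overline{\boldsymbol k}_1,\dots,\overline{\boldsymbol k}_{d+3}]\subset\mathbb R^{d+2}$ with $\boldsymbol P(\overline{\boldsymbol k}_i)=\boldsymbol k_i$, $\boldsymbol P$ the projection onto the first two coordinates, and set $Q[\mathcal K](\boldsymbol x)=\mathrm{area}(\Delta)\binom{d+2}2^{-1}\frac{\mathrm{vol}_d(\sigma\cap\boldsymbol P^{-1}(\boldsymbol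 x))}{\mathrm{vol}_{d+2}(\sigma)}$. Write $Q[ijklmn]=Q[\boldsymbol p_1^i\boldsymbol p_2^j\boldsymbol p_3^k\boldsymbol p_4^l\boldsymbol p_5^m\boldsymbol p_6^n]$ and $Q[ijklmn;o]$ if additionally $\boldsymbol p_{10}$ has multiplicity $o$ (exponents are multiplicities). **Bases**, $(n_0,n_1,n_2,n_3)=(12,10,12,16)$: - $S_{j,0}=\mathbf 1_{\Delta_j}$. - $\boldsymbol s_1$: $\frac14Q[200101]$, $\frac14Q[020110]$, $\frac14Q[002011]$, $\frac13Q[110100;1]$, $\frac13Q[011010;1]$, $\frac13Q[101001;1]$, $\frac13Q[100101;1]$, $\frac13Q[010110;1]$, $\frac13Q[001011;1]$, $\frac14Q[000111;1]$ (the nodal basis of the continuous piecewise linears: $S_{j,1}(\boldsymbol p_i)=\delta_{ij}$). - $\boldsymbol s_2$: $\frac14Q[300101]$, $\frac12Q[210101]$, $\frac34Q[110111]$, $\frac12Q[120110]$, $\frac14Q[030110]$, $\frac12Q[021110]$, $\frac34Q[011111]$, $\frac12Q[012011]$, $\frac14Q[003011]$, $\frac12Q[102011]$, $\frac34Q[101111]$, $\frac12Q[201101]$. - $\boldsymbol s_3$: $\frac14Q[400101]$, $\frac12Q[310101]$, $Q[221100]$, $\frac12Q[130110]$, $\frac14Q[040110]$, $\frac12Q[031110]$, $Q[122010]$, $\frac12Q[013011]$, $\frac14Q[004011]$, $\frac12Q[103011]$, $Q[212001]$, $\frac12Q[301101]$, $Q[211101]$, $Q[121110]$, $Q[112011]$,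 $\frac14Q[111111]$. **Dual polynomials.** With $c_j=c_j(\boldsymbol y)=1-\boldsymbol p_j^{\mathrm T}\boldsymbol y$, $j=1,\dots,10$: - $\boldsymbol\psi_0=[1,\dots,1]^{\mathrm T}\in\mathbb R^{12}$, - $\boldsymbol\psi_1=[c_1,c_2,\dots,c_{10}]^{\mathrm T}$, - $\boldsymbol\psi_2=[c_1^2,\ c_1c_4,\ c_4c_{10},\ c_2c_4,\ c_2^2,\ c_2c_5,\ c_5c_{10},\ c_3c_5,\ c_3^2,\ c_3c_6,\ c_6c_{10},\ c_1c_6]^{\mathrm T}$, - $\boldsymbol\psi_3=[c_1^3,\ c_1^2c_4,\ c_1c_2c_4,\ c_2^2c_4,\ c_2^3,\ c_2^2c_5,\ c_2c_3c_5,\ c_3^2c_5,\ c_3^3,\ c_3^2c_6,\ c_1c_3c_6,\ c_1^2c_6,\ c_1c_4c_6,\ c_2c_4c_5,\ c_3c_5c_6,\ c_1c_2c_3]^{\mathrm T}$. *)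

theory Defs
  imports "HOL-Analysis.Analysis" "HOL-Library.Multiset"
begin

text \<open>
  The vertices \<open>p\<^sub>1, \<dots>, p\<^sub>1\<^sub>0\<close> of the Powell--Sabin 12-split are a function on \<^typ>\<open>nat\<close> with
  1-based indices; its values outside \<open>{1..10}\<close> are irrelevant. All bases below are 1-based too.
\<close>

definition split12 :: "real^2 \<Rightarrow> real^2 \<Rightarrow> real^2 \<Rightarrow> nat \<Rightarrow> real^2" where
  "split12 p1 p2 p3 i =
    (let p4 = midpoint p1 p2; p5 = midpoint p2 p3; p6 = midpoint p3 p1;
         p7 = midpoint p4 p6; p8 = midpoint p4 p5; p9 = midpoint p5 p6;
         p10 = (1 / 3) *\<^sub>R (p1 + p2 + p3)
     in [p1, p2, p3, p4, p5, p6, p7, p8, p9, p10] ! (i - 1))"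

definition full_triangle :: "(nat \<Rightarrow> real^2) \<Rightarrow> (real^2) set" where
  "full_triangle p = convex hull {p 1, p 2, p 3}"

definition subtriangle_indices :: "(nat \<times> nat \<times> nat) list" where
  "subtriangle_indices =
    [(1,6,7), (1,4,7), (2,4,8), (2,5,8), (3,5,9), (3,6,9),
     (6,7,10), (4,7,10), (4,8,10), (5,8,10), (5,9,10), (6,9,10)]"

definition closed_subtriangle :: "(nat \<Rightarrow> real^2) \<Rightarrow> nat \<Rightarrow> (real^2) set" where
  "closed_subtriangle p k =
    (case subtriangle_indices ! (k - 1) of (a, b, c) \<Rightarrow> convex hull {p a, p b, p c})"

text \<open>
  The half-open subtriangles are any assignment of the points of the triangle to one of the closed
  subtriangles containing them; how the points on shared edges are assigned is left open.
\<close>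

definition half_open_split :: "(nat \<Rightarrow> real^2) \<Rightarrow> (nat \<Rightarrow> (real^2) set) \<Rightarrow> bool" where
  "half_open_split p T \<longleftrightarrow>
    (\<forall>k\<in>{1..12}. T k \<subseteq> closed_subtriangle p k) \<and>
    disjoint_family_on T {1..12} \<and>
    (\<Union>k\<in>{1..12}. T k) = full_triangle p"

text \<open>
  The space \<open>\<real>\<^sup>d\<^sup>+\<^sup>2\<close> is \<^typ>\<open>(real^2) \<times> 'e\<close> for a Euclidean space \<open>'e\<close> of dimension \<open>d\<close>, and the
  projection onto the first two coordinates is \<^const>\<open>fst\<close>. The set \<open>V\<close> consists of the vertices
  of a nondegenerate simplex whose projections, with multiplicities, are the knots in \<open>K\<close>.
\<close>

definition simplex_over :: "(real^2) multiset \<Rightarrow> ((real^2) \<times> 'e::euclidean_space) set \<Rightarrow> bool" where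
  "simplex_over K V \<longleftrightarrow>
    finite V \<and> card V = DIM('e) + 3 \<and> \<not> affine_dependent V \<and> image_mset fst (mset_set V) = K"

text \<open>
  The fibre of the simplex over \<open>x\<close> is identified with a subset of \<open>'e\<close>. Its volume relative to
  that of the simplex does not depend on the chosen simplex. The number \<open>A\<close> is the area of the
  triangle.
\<close>

definition simplex_spline ::
    "'e::euclidean_space itself \<Rightarrow> real \<Rightarrow> (real^2) multiset \<Rightarrow> real^2 \<Rightarrow> real" where
  "simplex_spline _ A K x =
    (let \<sigma> = convex hull (SOME V :: ((real^2) \<times> 'e) set. simplex_over K V)
     in A * inverse (real ((DIM('e) + 2) choose 2)) *
        (measure lebesgue {z :: 'e. (x, z) \<in> \<sigma>} / measure lebesgue \<sigma>))"

text \<open>\<open>knots p [i,j,k,l,m,n] r\<close> is the multiset of knots of \<open>Q[ijklmn;r]\<close>.\<close>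

definition knots :: "(nat \<Rightarrow> real^2) \<Rightarrow> nat list \<Rightarrow> nat \<Rightarrow> (real^2) multiset" where
  "knots p e r = (\<Sum>i<6. replicate_mset (e ! i) (p (Suc i))) + replicate_mset r (p 10)"

definition Q1 :: "(nat \<Rightarrow> real^2) \<Rightarrow> nat list \<Rightarrow> nat \<Rightarrow> real^2 \<Rightarrow> real" where
  "Q1 p e r = simplex_spline TYPE(real) (measure lebesgue (full_triangle p)) (knots p e r)"

definition Q2 :: "(nat \<Rightarrow> real^2) \<Rightarrow> nat list \<Rightarrow> real^2 \<Rightarrow> real" where
  "Q2 p e = simplex_spline TYPE(real^2) (measure lebesgue (full_triangle p)) (knots p e 0)"

definition Q3 :: "(nat \<Rightarrow> real^2) \<Rightarrow> nat list \<Rightarrow> real^2 \<Rightarrow> real" where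
  "Q3 p e = simplex_spline TYPE(real^3) (measure lebesgue (full_triangle p)) (knots p e 0)"

definition s0 :: "(nat \<Rightarrow> (real^2) set) \<Rightarrow> real^2 \<Rightarrow> real list" where
  "s0 T x = map (\<lambda>j. indicat_real (T j) x) [1..<13]"

definition s1 :: "(nat \<Rightarrow> real^2) \<Rightarrow> real^2 \<Rightarrow> real list" where
  "s1 p x =
    [1/4 * Q1 p [2,0,0,1,0,1] 0 x,
     1/4 * Q1 p [0,2,0,1,1,0] 0 x,
     1/4 * Q1 p [0,0,2,0,1,1] 0 x,
     1/3 * Q1 p [1,1,0,1,0,0] 1 x,
     1/3 * Q1 p [0,1,1,0,1,0] 1 x,
     1/3 * Q1 p [1,0,1,0,0,1] 1 x,
     1/3 * Q1 p [1,0,0,1,0,1] 1 x,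
     1/3 * Q1 p [0,1,0,1,1,0] 1 x,
     1/3 * Q1 p [0,0,1,0,1,1] 1 x,
     1/4 * Q1 p [0,0,0,1,1,1] 1 x]"

definition s2 :: "(nat \<Rightarrow> real^2) \<Rightarrow> real^2 \<Rightarrow> real list" where
  "s2 p x =
    [1/4 * Q2 p [3,0,0,1,0,1] x,
     1/2 * Q2 p [2,1,0,1,0,1] x,
     3/4 * Q2 p [1,1,0,1,1,1] x,
     1/2 * Q2 p [1,2,0,1,1,0] x,
     1/4 * Q2 p [0,3,0,1,1,0] x,
     1/2 * Q2 p [0,2,1,1,1,0] x,
     3/4 * Q2 p [0,1,1,1,1,1] x,
     1/2 * Q2 p [0,1,2,0,1,1] x,
     1/4 * Q2 p [0,0,3,0,1,1] x,
     1/2 * Q2 p [1,0,2,0,1,1] x,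
     3/4 * Q2 p [1,0,1,1,1,1] x,
     1/2 * Q2 p [2,0,1,1,0,1] x]"

definition s3 :: "(nat \<Rightarrow> real^2) \<Rightarrow> real^2 \<Rightarrow> real list" where
  "s3 p x =
    [1/4 * Q3 p [4,0,0,1,0,1] x,
     1/2 * Q3 p [3,1,0,1,0,1] x,
     Q3 p [2,2,1,1,0,0] x,
     1/2 * Q3 p [1,3,0,1,1,0] x,
     1/4 * Q3 p [0,4,0,1,1,0] x,
     1/2 * Q3 p [0,3,1,1,1,0] x,
     Q3 p [1,2,2,0,1,0] x,
     1/2 * Q3 p [0,1,3,0,1,1] x,
     1/4 * Q3 p [0,0,4,0,1,1] x,
     1/2 * Q3 p [1,0,3,0,1,1] x,
     Q3 p [2,1,2,0,0,1] x,
     1/2 * Q3 p [3,0,1,1,0,1] x,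
     Q3 p [2,1,1,1,0,1] x,
     Q3 p [1,2,1,1,1,0] x,
     Q3 p [1,1,2,0,1,1] x,
     1/4 * Q3 p [1,1,1,1,1,1] x]"

definition basis_vec ::
    "(nat \<Rightarrow> real^2) \<Rightarrow> (nat \<Rightarrow> (real^2) set) \<Rightarrow> nat \<Rightarrow> real^2 \<Rightarrow> real list" where
  "basis_vec p T d x = [s0 T x, s1 p x, s2 p x, s3 p x] ! d"

definition dual_vec :: "(nat \<Rightarrow> real^2) \<Rightarrow> nat \<Rightarrow> real^2 \<Rightarrow> real list" where
  "dual_vec p d y =
    (let c = (\<lambda>j. 1 - p j \<bullet> y) in
     [replicate 12 1,
      map c [1..<11],
      [c 1 ^ 2, c 1 * c 4, c 4 * c 10, c 2 * c 4, c 2 ^ 2, c 2 * c 5,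
       c 5 * c 10, c 3 * c 5, c 3 ^ 2, c 3 * c 6, c 6 * c 10, c 1 * c 6],
      [c 1 ^ 3, c 1 ^ 2 * c 4, c 1 * c 2 * c 4, c 2 ^ 2 * c 4,
       c 2 ^ 3, c 2 ^ 2 * c 5, c 2 * c 3 * c 5, c 3 ^ 2 * c 5,
       c 3 ^ 3, c 3 ^ 2 * c 6, c 1 * c 3 * c 6, c 1 ^ 2 * c 6,
       c 1 * c 4 * c 6, c 2 * c 4 * c 5, c 3 * c 5 * c 6, c 1 * c 2 * c 3]] ! d)"

definition basis_size :: "nat \<Rightarrow> nat" where
  "basis_size d = [12, 10, 12, 16] ! d"

definition S :: "(nat \<Rightarrow> real^2) \<Rightarrow> (nat \<Rightarrow> (real^2) set) \<Rightarrow> nat \<Rightarrow> nat \<Rightarrow> real^2 \<Rightarrow> real" where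
  "S p T j d x = basis_vec p T d x ! (j - 1)"

definition dual_poly :: "(nat \<Rightarrow> real^2) \<Rightarrow> nat \<Rightarrow> nat \<Rightarrow> real^2 \<Rightarrow> real" where
  "dual_poly p j d y = dual_vec p d y ! (j - 1)"

definition list_dot :: "real list \<Rightarrow> real list \<Rightarrow> real" where
  "list_dot u v = sum_list (map2 (*) u v)"

end

theory Submission
  imports Defs "HOL-Combinatorics.Permutations"
begin

text \<open>
  All simplices over the same knots are related by affine maps over the plane, so the normalised fibre
  volume can be computed with one convenient simplex: three non-collinear knots at height \<open>0\<close> and the
  remaining \<open>d\<close> knots at the unit vectors of \<open>\<real>\<^sup>d\<close>. The fibre over \<open>x\<close> is then the polytope of all
  \<open>u \<ge> 0\<close> with \<open>\<Sum>i. u\<^sub>i \<kappa>\<^sub>i \<le> \<beta>(x)\<close>, where \<open>\<kappa>\<^sub>i\<close> and \<open>\<beta>(x)\<close> are barycentric coordinates of knots and of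
  \<open>x\<close> relative to the three base knots. Slicing this polytope gives each spline as a combination of
  truncated powers of linear functions of the barycentric coordinates of \<open>x\<close>, and the Marsden identity
  becomes a polynomial identity on each of the twelve subtriangles, which symmetry reduces to two.
\<close>

section \<open>Barycentric coordinates and affine maps\<close>

text \<open>\<open>simplex_spline\<close> selects its simplex with \<open>SOME\<close>, so a value
  can be computed only once a simplex over the knots is known to exist and the ratio of volumes is
  known not to depend on it. The explicit simplex settles the first point, an affine map over the
  plane the second. Its sections at fixed height are, up to translation, images of sections of the
  standard simplex under one linear map of the plane. The scale factor of that map also gives the
  area of the base triangle, so it cancels and leaves \<open>d!\<close> times the fibre volume
  divided by that area.

  The shape of the triangle drops out as well: with \<open>c1\<close>, \<open>c2\<close>,
  \<open>c3\<close> the values of \<open>1 - p \<bullet> y\<close> at the vertices, both sides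
  depend only on these and on the barycentric coordinates of \<open>x\<close>, because
  \<open>1 - x \<bullet> y = b1 * c1 + b2 * c2 + b3 * c3\<close>. Sorting to
  \<open>b1 \<ge> b2 \<ge> b3\<close> selects one of the six sectors between the medians; the line
  \<open>b1 = 1/2\<close> through points 4 and 6 divides that sector into the subtriangles
  \<open>[1,4,7]\<close> and \<open>[4,7,10]\<close>, which are the two remaining cases.\<close>

lemma barycentric_unique_zero:
  fixes a b c :: "'a::euclidean_space"
  assumes nc: "\<not> collinear {a, b, c}"
    and eq: "u *\<^sub>R a + v *\<^sub>R b + w *\<^sub>R c = 0" and s: "u + v + w = 0"
  shows "u = 0 \<and> v = 0 \<and> w = 0"
proof -
  \<comment> \<open>A nonzero \<open>u\<close> would put \<open>a\<close> on the line through
    \<open>b\<close> and \<open>c\<close>. The claim is stated for arbitrary points because it is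
    applied twice, to \<open>a\<close> and then to \<open>b\<close>.\<close>
  have key: "u = 0" if nc: "\<not> collinear {b, a, c}"
    and eq: "u *\<^sub>R a + v *\<^sub>R b + w *\<^sub>R c = 0" and s: "u + v + w = 0"
    for a b c :: 'a and u v w
  proof (rule ccontr)
    assume u: "u \<noteq> 0"
    have "u *\<^sub>R a = - v *\<^sub>R b - w *\<^sub>R c"
      using eq by (simp add: algebra_simps eq_neg_iff_add_eq_0)
    then have "a = inverse u *\<^sub>R (- v *\<^sub>R b - w *\<^sub>R c)"
      using u by (metis left_inverse scaleR_one scaleR_scaleR)
    also have "\<dots> = (- v / u) *\<^sub>R b + (- w / u) *\<^sub>R c"
      by (simp add: scaleR_right_diff_distrib divide_inverse mult.commute)
    also have "- w / u = 1 - (- v / u)"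
    proof -
      have "w = - u - v" using s by linarith
      then show ?thesis using u by (simp add: field_simps)
    qed
    finally have "\<exists>t. a = t *\<^sub>R b + (1 - t) *\<^sub>R c" by blast
    then show False
      using nc collinear_3_expand by blast
  qed
  have "u = 0" using key[of b a c u v w] nc eq s by (simp add: insert_commute)
  moreover have "v = 0" using key[of a b c v u w] nc eq s by (simp add: insert_commute ac_simps)
  ultimately show ?thesis using s by simp
qed

lemma barycentric_unique:
  fixes a b c :: "'a::euclidean_space"
  assumes nc: "\<not> collinear {a, b, c}" and s: "u + v + w = u' + v' + w'"
  shows "u *\<^sub>R a + v *\<^sub>R b + w *\<^sub>R c = u' *\<^sub>R a + v' *\<^sub>R b + w' *\<^sub>R c
    \<longleftrightarrow> u = u' \<and> v = v' \<and> w = w'"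
proof
  assume "u *\<^sub>R a + v *\<^sub>R b + w *\<^sub>R c = u' *\<^sub>R a + v' *\<^sub>R b + w' *\<^sub>R c"
  then have "(u - u') *\<^sub>R a + (v - v') *\<^sub>R b + (w - w') *\<^sub>R c = 0"
    by (simp add: algebra_simps)
  with barycentric_unique_zero[OF nc this] s show "u = u' \<and> v = v' \<and> w = w'" by simp
qed simp

text \<open>Differences from one point of an affinely independent set are linearly independent, so a
  linear map can be prescribed on them; the translation \<open>b\<close> then corrects the value at
  the chosen point.\<close>

lemma affine_independent_extend:
  fixes V :: "'a::real_vector set" and h :: "'a \<Rightarrow> 'b::real_vector"
  assumes "\<not> affine_dependent V"
  obtains f b where "linear f" "\<And>v. v \<in> V \<Longrightarrow> f v + b = h v"
proof (cases "V = {}")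
  case True
  then show ?thesis using that[of "\<lambda>_. 0"] module_hom_zero by (auto simp: linear_def)
next
  case False
  then obtain a where a: "a \<in> V" by auto
  then have "independent ((\<lambda>x. - a + x) ` (V - {a}))"
    using assms affine_dependent_iff_dependent2 by blast
  then obtain f where f: "linear f"
    and fv: "\<forall>x\<in>(\<lambda>x. - a + x) ` (V - {a}). f x = h (a + x) - h a"
    using linear_independent_extend[of _ "\<lambda>x. h (a + x) - h a"] by blast
  have "f v + (h a - f a) = h v" if "v \<in> V" for v
  proof (cases "v = a")
    case False
    then have "f (- a + v) = h v - h a" using fv that by auto
    moreover have "f (- a + v) = f v - f a"
      using f by (simp add: linear_diff flip: diff_conv_add_uminus)
    ultimately have "f v - f a = h v - h a" by simp
    then show ?thesis by (metis add.commute add_diff_eq diff_add_cancel)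
  qed simp
  then show ?thesis using that f by blast
qed

text \<open>Matches the vertices of two simplices over the same knots even when knots repeat: any
  bijection between the sets is corrected by a permutation of \<open>A\<close> that makes the values
  agree.\<close>

lemma image_mset_eq_imp_bij_betw:
  assumes "finite A" "finite B"
    and eq: "image_mset f (mset_set A) = image_mset g (mset_set B)"
  obtains h where "bij_betw h A B" "\<And>a. a \<in> A \<Longrightarrow> g (h a) = f a"
proof -
  have "card A = card B"
    using arg_cong[OF eq, of size] by simp
  then obtain j where j: "bij_betw j A B"
    using assms finite_same_card_bij by blast
  have "image_mset g (mset_set B) = image_mset (g \<circ> j) (mset_set A)"
    using j by (simp add: bij_betw_def image_mset_mset_set flip: multiset.map_comp)
  with eq obtain r where r: "r permutes A" "\<forall>x\<in>A. f x = (g \<circ> j) (r x)"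
    using image_mset_eq_implies_permutes[OF assms(1), of f "g \<circ> j"] by auto
  show ?thesis
  proof (rule that)
    show "bij_betw (j \<circ> r) A B"
      using j r(1) permutes_imp_bij bij_betw_trans by blast
  qed (use r(2) in auto)
qed

section \<open>Slices of compact sets\<close>

lemma emeasure_lborel_compact:
  "compact U \<Longrightarrow> emeasure lborel U = ennreal (measure lebesgue U)"
  using emeasure_eq_measure2[OF lmeasurable_compact, of U]
  by (simp add: emeasure_completion borel_compact)

lemma compact_slice_snd:
  fixes U :: "('a::euclidean_space \<times> 'b::euclidean_space) set"
  assumes "compact U"
  shows "compact {z. (x, z) \<in> U}"
proof -
  have "{z. (x, z) \<in> U} = snd ` (U \<inter> (fst -` {x}))" by force
  moreover have "compact (U \<inter> (fst -` {x}))"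
    using assms by (intro compact_Int_closed closed_vimage) (auto intro: continuous_intros)
  ultimately show ?thesis
    by (simp add: compact_continuous_image continuous_on_snd)
qed

lemma compact_slice_fst:
  fixes U :: "('a::euclidean_space \<times> 'b::euclidean_space) set"
  assumes "compact U"
  shows "compact {x. (x, z) \<in> U}"
proof -
  have "{x. (x, z) \<in> U} = fst ` (U \<inter> (snd -` {z}))" by force
  moreover have "compact (U \<inter> (snd -` {z}))"
    using assms by (intro compact_Int_closed closed_vimage) (auto intro: continuous_intros)
  ultimately show ?thesis
    by (simp add: compact_continuous_image continuous_on_fst)
qed

text \<open>Tonelli's theorem in both orders. Compactness makes the set Borel and every slice of
  finite measure, so the real-valued \<open>measure\<close> can stand in for
  \<open>emeasure\<close>.\<close>

lemma
  fixes U :: "('a::euclidean_space \<times> 'b::euclidean_space) set"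
  assumes U: "compact U"
  shows measurable_slices_snd: "(\<lambda>x. measure lebesgue {z. (x, z) \<in> U}) \<in> borel_measurable borel"
    and measurable_slices_fst: "(\<lambda>z. measure lebesgue {x. (x, z) \<in> U}) \<in> borel_measurable borel"
    and emeasure_slices_snd:
      "emeasure lborel U = (\<integral>\<^sup>+x. ennreal (measure lebesgue {z. (x, z) \<in> U}) \<partial>lborel)"
    and emeasure_slices_fst:
      "emeasure lborel U = (\<integral>\<^sup>+z. ennreal (measure lebesgue {x. (x, z) \<in> U}) \<partial>lborel)"
proof -
  have U': "U \<in> sets ((lborel :: 'a measure) \<Otimes>\<^sub>M (lborel :: 'b measure))"
    using U unfolding lborel_prod by (simp add: borel_compact)
  have 1: "emeasure lborel (Pair x -` U) = ennreal (measure lebesgue {z. (x, z) \<in> U})" for x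
    using emeasure_lborel_compact[OF compact_slice_snd[OF U, of x]] by (simp add: vimage_def)
  have 2: "emeasure lborel ((\<lambda>x. (x, z)) -` U) = ennreal (measure lebesgue {x. (x, z) \<in> U})" for z
    using emeasure_lborel_compact[OF compact_slice_fst[OF U, of z]] by (simp add: vimage_def)
  show "emeasure lborel U = (\<integral>\<^sup>+x. ennreal (measure lebesgue {z. (x, z) \<in> U}) \<partial>lborel)"
    using lborel.emeasure_pair_measure_alt[OF U'] by (simp add: 1 lborel_prod)
  show "emeasure lborel U = (\<integral>\<^sup>+z. ennreal (measure lebesgue {x. (x, z) \<in> U}) \<partial>lborel)"
    using lborel_pair.emeasure_pair_measure_alt2[OF U'] by (simp add: 2 lborel_prod)
  have "(\<lambda>x. enn2real (emeasure lborel (Pair x -` U))) \<in> borel_measurable lborel"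
    using lborel.measurable_emeasure_Pair[OF U'] by measurable
  then show "(\<lambda>x. measure lebesgue {z. (x, z) \<in> U}) \<in> borel_measurable borel"
    by (simp add: 1)
  have "(\<lambda>z. enn2real (emeasure lborel ((\<lambda>x. (x, z)) -` U))) \<in> borel_measurable lborel"
    using lborel_pair.measurable_emeasure_Pair2[OF U'] by measurable
  then show "(\<lambda>z. measure lebesgue {x. (x, z) \<in> U}) \<in> borel_measurable borel"
    by (simp add: 2)
qed

text \<open>Cavalieri's principle over the first coordinate. It compares two simplices over the same
  knots, whose fibres all have the same ratio.\<close>

lemma measure_proportional_slices_snd:
  fixes U U' :: "('a::euclidean_space \<times> 'b::euclidean_space) set"
  assumes U: "compact U" and U': "compact U'" and c: "0 \<le> c"
    and eq: "\<And>x. measure lebesgue {z. (x, z) \<in> U'} = c * measure lebesgue {z. (x, z) \<in> U}"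
  shows "measure lebesgue U' = c * measure lebesgue U"
proof -
  have "ennreal (measure lebesgue U') = (\<integral>\<^sup>+x. ennreal (c * measure lebesgue {z. (x,
      z) \<in> U}) \<partial>lborel)"
    using emeasure_slices_snd[OF U'] emeasure_lborel_compact[OF U'] by (simp add: eq)
  also have "\<dots> = (\<integral>\<^sup>+x. ennreal c * ennreal (measure lebesgue {z. (x, z) \<in> U}) \<partial>lborel)"
    using c by (simp add: ennreal_mult)
  also have "\<dots> = ennreal c * emeasure lborel U"
    using measurable_slices_snd[OF U] by (subst nn_integral_cmult) (simp_all add:
        emeasure_slices_snd[OF U])
  also have "\<dots> = ennreal (c * measure lebesgue U)"
    using c by (simp add: emeasure_lborel_compact[OF U] ennreal_mult)
  finally show ?thesis using c by (simp add: ennreal_inj)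
qed

text \<open>Cavalieri's principle over the second coordinate. It compares the explicit simplex with
  the standard one, where it is the sections at fixed height that keep a constant ratio.\<close>

lemma measure_proportional_slices_fst:
  fixes U U' :: "('a::euclidean_space \<times> 'b::euclidean_space) set"
  assumes U: "compact U" and U': "compact U'" and c: "0 \<le> c"
    and eq: "\<And>z. measure lebesgue {x. (x, z) \<in> U'} = c * measure lebesgue {x. (x, z) \<in> U}"
  shows "measure lebesgue U' = c * measure lebesgue U"
proof -
  have "ennreal (measure lebesgue U') = (\<integral>\<^sup>+z. ennreal (c * measure lebesgue {x. (x,
      z) \<in> U}) \<partial>lborel)"
    using emeasure_slices_fst[OF U'] emeasure_lborel_compact[OF U'] by (simp add: eq)
  also have "\<dots> = (\<integral>\<^sup>+z. ennreal c * ennreal (measure lebesgue {x. (x, z) \<in> U}) \<partial>lborel)"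
    using c by (simp add: ennreal_mult)
  also have "\<dots> = ennreal c * emeasure lborel U"
    using measurable_slices_fst[OF U] by (subst nn_integral_cmult) (simp_all add:
        emeasure_slices_fst[OF U])
  also have "\<dots> = ennreal (c * measure lebesgue U)"
    using c by (simp add: emeasure_lborel_compact[OF U] ennreal_mult)
  finally show ?thesis using c by (simp add: ennreal_inj)
qed

section \<open>Independence of the chosen simplex\<close>

text \<open>Linear maps are known to scale Lebesgue measure on \<open>real\<close> and on \<open>real^'n\<close>, not on an
  arbitrary Euclidean space, so this property is carried as a hypothesis.\<close>

definition linear_maps_scale_measure :: "'e::euclidean_space itself \<Rightarrow> bool" where
  "linear_maps_scale_measure _ \<longleftrightarrow>
    (\<forall>f :: 'e \<Rightarrow> 'e. linear f \<longrightarrow>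
      (\<exists>c\<ge>0. \<forall>U. compact U \<longrightarrow> measure lebesgue (f ` U) = c * measure lebesgue U))"

lemma linear_maps_scale_measure_real: "linear_maps_scale_measure TYPE(real)"
  unfolding linear_maps_scale_measure_def
proof (intro allI impI)
  fix f :: "real \<Rightarrow> real"
  assume "linear f"
  then have f: "f = (\<lambda>x. f 1 *\<^sub>R x + 0)"
    by (metis add.right_neutral linear_scale mult.commute mult.right_neutral real_scaleR_def)
  have "measure lebesgue (f ` U) = \<bar>f 1\<bar> * measure lebesgue U" for U
    by (subst f, subst measure_lebesgue_affine) simp
  then show "\<exists>c\<ge>0. \<forall>U. compact U \<longrightarrow> measure lebesgue (f ` U) = c * measure lebesgue U"
    by (intro exI[of _ "\<bar>f 1\<bar>"]) auto
qed

lemma linear_maps_scale_measure_vec: "linear_maps_scale_measure TYPE(real^'n::{finite,wellorder})"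
  unfolding linear_maps_scale_measure_def
  by (metis abs_ge_zero lmeasurable_compact measure_linear_image)

text \<open>\<open>d + 3\<close> affinely independent points in dimension \<open>d + 2\<close> have
  a hull with interior, and a convex set with interior is not negligible. Positivity is what rules
  out a zero scale factor later.\<close>

lemma simplex_over_measure_pos:
  assumes "simplex_over K (V :: ((real^2) \<times> 'e::euclidean_space) set)"
  shows "measure lebesgue (convex hull V) > 0"
proof -
  have V: "finite V" "card V = Suc DIM((real^2) \<times> 'e)" "\<not> affine_dependent V"
    using assms by (auto simp: simplex_over_def)
  then have "\<not> negligible (convex hull V)"
    using interior_convex_hull_eq_empty[OF V(2)] negligible_convex_interior convex_convex_hull
        by blast
  moreover have "convex hull V \<in> lmeasurable"
    using V(1) by (simp add: lmeasurable_compact finite_imp_compact_convex_hull)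
  ultimately show ?thesis
    by (metis less_eq_real_def measure_nonneg negligible_iff_measure0)
qed

text \<open>The affine bijection between two simplices over the same knots that matches vertices with the
  same projection preserves fibres and scales all of them by the same factor.\<close>

lemma simplex_over_ratio_unique:
  fixes V V' :: "((real^2) \<times> 'e::euclidean_space) set"
  assumes lin: "linear_maps_scale_measure TYPE('e)"
    and V: "simplex_over K V" and V': "simplex_over K V'"
  shows "measure lebesgue {z. (x, z) \<in> convex hull V} / measure lebesgue (convex hull V)
    = measure lebesgue {z. (x, z) \<in> convex hull V'} / measure lebesgue (convex hull V')"
proof -
  note D = V[unfolded simplex_over_def] V'[unfolded simplex_over_def]
  obtain h where h: "bij_betw h V V'" "\<And>v. v \<in> V \<Longrightarrow> fst (h v) = fst v"
    using image_mset_eq_imp_bij_betw[of V V' fst fst] D by metis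
  obtain f b where f: "linear f" and fb: "\<And>v. v \<in> V \<Longrightarrow> f v + b = h v"
    using affine_independent_extend[of V h] D by blast
  let ?F = "\<lambda>v. f v + b"
  have VF: "V' = ?F ` V"
    using h(1) fb by (auto simp: bij_betw_def)
  have hull: "convex hull V' = ?F ` (convex hull V)"
  proof -
    have *: "?F ` A = (+) b ` f ` A" for A
      by (auto simp: add.commute image_image)
    show ?thesis unfolding VF *
      by (simp add: convex_hull_translation convex_hull_linear_image f)
  qed
  \<comment> \<open>The vertices span the whole space affinely, so an affine condition checked on
    them holds everywhere; this is how \<open>fst_F\<close> follows.\<close>
  have "affine hull V = UNIV"
    using D affine_independent_span_eq[of V] by simp
  have fst_F: "fst (?F v) = fst v" for v
  proof -
    have "affine {v. fst (?F v) = fst v}"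
      unfolding affine_def
    proof safe
      fix v w u t
      assume "fst (?F v) = fst v" "fst (?F w) = fst w" and ut: "u + t = (1::real)"
      then have e: "fst v = fst (f v) + fst b" "fst w = fst (f w) + fst b" by auto
      have "fst b = u *\<^sub>R fst b + t *\<^sub>R fst b" using ut by (metis scaleR_add_left scaleR_one)
      then show "fst (?F (u *\<^sub>R v + t *\<^sub>R w)) = fst (u *\<^sub>R v + t *\<^sub>R w)"
        using f by (simp add: e linear_add linear_scale scaleR_add_right)
    qed
    moreover have "V \<subseteq> {v. fst (?F v) = fst v}"
    proof
      fix v assume "v \<in> V"
      then show "v \<in> {v. fst (?F v) = fst v}" by (simp only: fb h(2) mem_Collect_eq)
    qed
    ultimately have "affine hull V \<subseteq> {v. fst (?F v) = fst v}" by (rule hull_minimal[rotated])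
    then show ?thesis using \<open>affine hull V = UNIV\<close> by auto
  qed
  \<comment> \<open>The action of the affine map on vertical directions. Over \<open>x\<close> it is
    followed by a translation depending on \<open>x\<close>, so all fibres are scaled by the single
    factor of \<open>M\<close>.\<close>
  define M where "M z = snd (f (0, z))" for z
  have split: "?F (x, z) = (x, M z + (snd (f (x, 0)) + snd b))" for x z
  proof -
    have "f (x, z) = f (x, 0) + f (0, z)"
      using f by (metis add_Pair add_0 add.right_neutral linear_add)
    then have "snd (?F (x, z)) = M z + (snd (f (x, 0)) + snd b)"
      by (simp add: M_def ac_simps)
    then show ?thesis using fst_F[of "(x, z)"] by (metis fst_conv prod.collapse)
  qed
  have "linear (\<lambda>z::'e. ((0::real^2), z))"
    by (intro linearI) auto
  then have "linear M"
    unfolding M_def using linear_compose[of "\<lambda>z. (0, z)" f] linear_compose[OF _ linear_snd] f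
    by (simp add: o_def)
  then obtain c where c: "c \<ge> 0"
    "\<And>U. compact U \<Longrightarrow> measure lebesgue (M ` U) = c * measure lebesgue U"
    using lin unfolding linear_maps_scale_measure_def by blast
  have comp: "compact (convex hull V)" "compact (convex hull V')"
    using D by (auto simp: finite_imp_compact_convex_hull)
  have slice: "measure lebesgue {z. (x, z) \<in> convex hull V'}
      = c * measure lebesgue {z. (x, z) \<in> convex hull V}" for x
  proof -
    have "{z. (x, z) \<in> convex hull V'} = (+) (snd (f (x, 0)) + snd b) ` M ` {z. (x,
        z) \<in> convex hull V}"
    proof -
      have "(x, z) \<in> convex hull V' \<longleftrightarrow>
        (\<exists>w. (x, w) \<in> convex hull V \<and> z = (snd (f (x, 0)) + snd b) + M w)" for z
        unfolding hull image_iff Bex_def split_paired_Ex split prod.inject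
        by (auto simp: ac_simps)
      then show ?thesis by auto
    qed
    then show ?thesis
      using c(2)[OF compact_slice_snd[OF comp(1)]] by (simp add: measure_translation)
  qed
  have tot: "measure lebesgue (convex hull V') = c * measure lebesgue (convex hull V)"
    using measure_proportional_slices_snd[OF comp c(1) slice] .
  have "c \<noteq> 0" using tot simplex_over_measure_pos[OF V'] by auto
  then show ?thesis by (simp add: slice tot)
qed

section \<open>The fibres of an explicit simplex\<close>

lemma measure_lebesgue_eq_lborel:
  "compact U \<Longrightarrow> measure lebesgue U = measure lborel U"
  by (simp add: measure_completion borel_compact)

lemma Basis_vec2: "(Basis :: (real^2) set) = {axis 1 1, axis 2 1}"
  by (auto simp: Basis_vec_def UNIV_2)

lemma axis12_neq: "axis 1 1 \<noteq> (axis 2 1 :: real^2)"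
  by (simp add: axis_eq_axis)

lemma sum_Basis_inner_scaleR:
  fixes v :: "'e::euclidean_space \<Rightarrow> 'b::real_vector"
  assumes "i \<in> Basis"
  shows "(\<Sum>j\<in>Basis. (i \<bullet> j) *\<^sub>R v j) = v i"
proof -
  have "(\<Sum>j\<in>Basis. (i \<bullet> j) *\<^sub>R v j) = (\<Sum>j\<in>Basis. if j = i then v j else 0)"
    using assms by (intro sum.cong) (auto simp: inner_Basis)
  then show ?thesis using assms by simp
qed

lemma sum_inner_Basis_prod:
  fixes w :: "'a::euclidean_space" and u :: "'b::euclidean_space"
  shows "(\<Sum>i\<in>Basis. (w, u) \<bullet> i) = (\<Sum>i\<in>Basis. w \<bullet> i) + (\<Sum>i\<in>Basis. u \<bullet> i)"
  unfolding Basis_prod_def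
  by (subst sum.union_disjoint) (auto simp: sum.reindex inj_on_def)

text \<open>Separates the three vertices that will carry the base knots from the unit vectors that
  will carry the remaining ones.\<close>

lemma mset_set_insert0_Basis_prod:
  "mset_set (insert 0 (Basis :: ((real^2) \<times> 'e::euclidean_space) set))
    = {#0, (axis 1 1, 0), (axis 2 1, 0)#} + image_mset (Pair 0) (mset_set Basis)"
proof -
  let ?E = "{0, (axis 1 1, 0), (axis 2 1, 0)} :: ((real^2) \<times> 'e) set"
  have ne: "axis 1 1 \<noteq> (0::real^2)" "axis 2 1 \<noteq> (0::real^2)"
    by (simp_all add: axis_eq_0_iff)
  have eq: "insert 0 Basis = ?E \<union> Pair 0 ` (Basis :: 'e set)"
    by (auto simp: Basis_prod_def Basis_vec2)
  have disj: "?E \<inter> Pair 0 ` (Basis :: 'e set) = {}"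
    using ne by (auto simp: zero_prod_def)
  have "mset_set ?E = {#0, (axis 1 1, 0), (axis 2 1, 0)#}"
    using ne axis12_neq by (simp add: zero_prod_def)
  moreover have "mset_set (Pair (0::real^2) ` (Basis :: 'e set)) =
      image_mset (Pair 0) (mset_set Basis)"
    by (subst image_mset_mset_set) (auto intro: inj_onI)
  ultimately show ?thesis
    unfolding eq using disj by (subst mset_set_Union) auto
qed

text \<open>The simplex is the image of the standard one under \<open>F\<close>, which sends
  \<open>0\<close> and the two plane unit vectors to the base knots at height \<open>0\<close>, and
  each unit vector \<open>i\<close> of the fibre space to \<open>(k i, i)\<close>. In
  \<open>P\<close> the numbers \<open>l0\<close>, \<open>l1\<close>, \<open>l2\<close> and the
  coordinates of \<open>u\<close> are the weights of a convex combination of the vertices that lies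
  over \<open>x\<close>.\<close>

lemma simplex_spline_eq:
  fixes k :: "'e::euclidean_space \<Rightarrow> real^2" and x :: "real^2"
  assumes lin: "linear_maps_scale_measure TYPE('e)"
    and nc: "\<not> collinear {q0, q1, q2}"
  defines "P \<equiv> {u :: 'e. (\<forall>i\<in>Basis. 0 \<le> u \<bullet> i) \<and>
      (\<exists>l0 l1 l2. 0 \<le> l0 \<and> 0 \<le> l1 \<and> 0 \<le> l2 \<and> l0 + l1 + l2 + (\<Sum>i\<in>Basis. u \<bullet> i) = 1 \<and>
        l0 *\<^sub>R q0 + l1 *\<^sub>R q1 + l2 *\<^sub>R q2 + (\<Sum>i\<in>Basis. (u \<bullet> i) *\<^sub>R k i) = x)}"
  shows "compact P"
    and "simplex_spline TYPE('e) A ({#q0, q1, q2#} + image_mset k (mset_set Basis)) x =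
      A * fact DIM('e) * measure lebesgue P / measure lebesgue (convex hull {q0, q1, q2})"
      (is "simplex_spline _ A ?K x = A * _ * measure lebesgue P / measure lebesgue ?tri")
proof -
  define g where "g w = w $ 1 *\<^sub>R (q1 - q0) + w $ 2 *\<^sub>R (q2 - q0)" for w :: "real^2"
  define s where "s u = (\<Sum>i\<in>Basis. (u \<bullet> i) *\<^sub>R (k i - q0))" for u :: 'e
  define L where "L v = (g (fst v) + s (snd v), snd v)" for v :: "(real^2) \<times> 'e"
  define B where "B = insert 0 (Basis :: ((real^2) \<times> 'e) set)"
  define F where "F v = (q0, 0) + L v" for v
  define V where "V = F ` B"
  have lg: "linear g"
    unfolding g_def by (intro linearI) (auto simp: algebra_simps)
  have ls: "linear s"
    unfolding s_def
    by (intro linearI) (auto simp: inner_add_left scaleR_add_left sum.distrib scaleR_sum_right)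
  have lL: "linear L"
    unfolding L_def
    by (intro linearI) (auto simp: linear_add[OF lg] linear_add[OF ls] linear_scale[OF lg]
        linear_scale[OF ls] algebra_simps)
  have injL: "inj L"
    unfolding linear_injective_0[OF lL]
  proof safe
    fix w :: "real^2" and u :: 'e
    assume "L (w, u) = 0"
    then have "u = 0" and "g w = 0" using linear_0[OF ls] by (auto simp: L_def zero_prod_def)
    then have "(- w $ 1 - w $ 2) *\<^sub>R q0 + w $ 1 *\<^sub>R q1 + w $ 2 *\<^sub>R q2 = 0"
      by (simp add: g_def algebra_simps)
    from barycentric_unique_zero[OF nc this] have "w = 0"
      by (simp add: vec_eq_iff forall_2)
    with \<open>u = 0\<close> show "(w, u) = 0" by (simp add: zero_prod_def)
  qed
  then have injF: "inj F"
    unfolding F_def inj_def by auto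
  have "finite B" by (simp add: B_def)
  have cB: "card B = DIM('e) + 3"
    by (simp add: B_def)
  \<comment> \<open>Up to the translation by \<open>(q0, 0)\<close> one vertex is the origin, so
    affine independence reduces to linear independence of the image of the basis under the injective
    map \<open>L\<close>.\<close>
  have indep: "\<not> affine_dependent V"
  proof -
    have "L v = 0 \<longleftrightarrow> v = 0" for v
      using injL linear_0[OF lL] by (metis injD)
    then have "0 \<notin> L ` Basis"
      by (metis imageE nonzero_Basis)
    then have "L ` B - {0} = L ` Basis"
      using linear_0[OF lL] by (simp add: B_def)
    moreover have "independent (L ` Basis)"
      using lL injL by (simp add: linear_independent_injective_image independent_Basis
          inj_on_subset)
    moreover have "0 \<in> L ` B" using linear_0[OF lL] by (force simp: B_def)
    ultimately have "\<not> affine_dependent (L ` B)"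
      by (simp add: affine_dependent_iff_dependent2[of 0])
    moreover have "V = (\<lambda>v. (q0, 0) + v) ` L ` B" by (auto simp: V_def F_def)
    ultimately show ?thesis
      using affine_dependent_translation_eq by metis
  qed
  have "image_mset fst (mset_set V) = image_mset (fst \<circ> F) (mset_set B)"
    unfolding V_def using injF
    by (simp add: image_mset_mset_set inj_on_subset flip: multiset.map_comp)
  also have "\<dots> = {#fst (F 0), fst (F (axis 1 1, 0)), fst (F (axis 2 1, 0))#}
      + image_mset (fst \<circ> F \<circ> Pair 0) (mset_set Basis)"
    unfolding B_def mset_set_insert0_Basis_prod by (simp add: multiset.map_comp o_assoc)
  also have "image_mset (fst \<circ> F \<circ> Pair 0) (mset_set Basis) = image_mset k (mset_set Basis)"
    by (intro image_mset_cong) (auto simp: F_def L_def s_def sum_Basis_inner_scaleR linear_0[OF lg])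
  also have "fst (F 0) = q0" using linear_0[OF lL] by (simp add: F_def)
  also have "fst (F (axis 1 1, 0)) = q1"
    using linear_0[OF ls] by (simp add: F_def L_def g_def axis_def)
  also have "fst (F (axis 2 1, 0)) = q2"
    using linear_0[OF ls] by (simp add: F_def L_def g_def axis_def)
  finally have over: "simplex_over ?K V"
    unfolding simplex_over_def using indep \<open>finite B\<close> cB injF
    by (simp add: V_def card_image inj_on_subset)
  have hull: "convex hull V = F ` (convex hull B)"
  proof -
    have "V = (+) (q0, 0) ` L ` B" by (auto simp: V_def F_def)
    moreover have "F ` (convex hull B) = (+) (q0, 0) ` L ` (convex hull B)"
      by (auto simp: F_def)
    ultimately show ?thesis by (simp add: convex_hull_translation convex_hull_linear_image lL)
  qed
  have std: "(w, u) \<in> convex hull B \<longleftrightarrow> 0 \<le> w $ 1 \<and> 0 \<le> w $ 2 \<and> (\<forall>i\<in>Basis. 0 \<le> u \<bullet> i) \<and>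
    w $ 1 + w $ 2 + (\<Sum>i\<in>Basis. u \<bullet> i) \<le> 1" for w u
  proof -
    have "(\<Sum>i\<in>Basis. (w, u) \<bullet> i) = w $ 1 + w $ 2 + (\<Sum>i\<in>Basis. u \<bullet> i)"
      unfolding sum_inner_Basis_prod using axis12_neq by (simp add: Basis_vec2 inner_axis)
    then show ?thesis
      unfolding B_def std_simplex by (auto simp: Basis_prod_def Basis_vec2 inner_axis)
  qed
  have slice: "{u. (x, u) \<in> convex hull V} = P"
  proof -
    have "(x, u) \<in> convex hull V \<longleftrightarrow> u \<in> P" for u
    proof -
      have "(x, u) \<in> convex hull V \<longleftrightarrow> (\<exists>w. (w, u) \<in> convex hull B \<and> x = q0 + (g w + s u))"
        unfolding hull image_iff Bex_def split_paired_Ex by (auto simp: F_def L_def)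
      also have "\<dots> \<longleftrightarrow> u \<in> P"
      proof
        assume "\<exists>w. (w, u) \<in> convex hull B \<and> x = q0 + (g w + s u)"
        then obtain w where w: "(w, u) \<in> convex hull B" "x = q0 + (g w + s u)" by blast
        \<comment> \<open>The weight of \<open>q0\<close> is what the other weights leave of
          \<open>1\<close>.\<close>
        then show "u \<in> P"
          unfolding std P_def mem_Collect_eq
          by (intro conjI exI[of _ "1 - w $ 1 - w $ 2 - (\<Sum>i\<in>Basis. u \<bullet> i)"]
              exI[of _ "w $ 1"] exI[of _ "w $ 2"])
            (auto simp: g_def s_def algebra_simps sum_subtractf scaleR_sum_left)
      next
        assume "u \<in> P"
        then obtain l0 l1 l2 where l: "\<forall>i\<in>Basis. 0 \<le> u \<bullet> i" "0 \<le> l0" "0 \<le> l1" "0 \<le> l2"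
          "l0 + l1 + l2 + (\<Sum>i\<in>Basis. u \<bullet> i) = 1"
          "l0 *\<^sub>R q0 + l1 *\<^sub>R q1 + l2 *\<^sub>R q2 + (\<Sum>i\<in>Basis. (u \<bullet> i) *\<^sub>R k i) = x" by (auto simp: P_def)
        have l0: "l0 = 1 - l1 - l2 - (\<Sum>i\<in>Basis. u \<bullet> i)" using l(5) by simp
        show "\<exists>w. (w, u) \<in> convex hull B \<and> x = q0 + (g w + s u)"
          by (rule exI[of _ "vector [l1, l2]"], unfold std l(6)[symmetric] l0)
            (use l(1-5) in \<open>auto simp: g_def s_def algebra_simps sum_subtractf scaleR_sum_left\<close>)
      qed
      finally show ?thesis .
    qed
    then show ?thesis by blast
  qed
  \<comment> \<open>\<open>c\<close> is the area factor of \<open>g\<close>, which maps the standard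
    triangle to a translate of the base triangle. The section of the simplex at height
    \<open>u\<close> is a translate of a \<open>g\<close>-image, so \<open>c\<close> scales the
    total volume too.\<close>
  obtain c where c: "c \<ge> 0" "\<And>U. compact U \<Longrightarrow> measure lebesgue (g ` U) = c * measure lebesgue U"
    using linear_maps_scale_measure_vec[where 'n=2] lg unfolding linear_maps_scale_measure_def
        by blast
  have cpt: "compact (convex hull B)" "compact (convex hull V)"
    using \<open>finite B\<close> by (auto simp: V_def finite_imp_compact_convex_hull)
  show "compact P"
    using compact_slice_snd[OF cpt(2), of x] unfolding slice .
  have "measure lebesgue {y. (y, u) \<in> convex hull V} = c * measure lebesgue {w. (w,
      u) \<in> convex hull B}"
    for u
  proof -
    have "{y. (y, u) \<in> convex hull V} = (+) (q0 + s u) ` g ` {w. (w, u) \<in> convex hull B}"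
      unfolding hull image_iff Bex_def split_paired_Ex
      by (auto simp: F_def L_def image_iff ac_simps)
    then show ?thesis
      using c(2)[OF compact_slice_fst[OF cpt(1)]] by (simp add: measure_translation)
  qed
  from measure_proportional_slices_fst[OF cpt c(1) this]
  have vol: "measure lebesgue (convex hull V) = c / fact (DIM('e) + 2)"
    using content_std_simplex[where 'a = "(real^2) \<times> 'e"] measure_lebesgue_eq_lborel[OF cpt(1)]
    by (simp add: B_def add.commute)
  have tri: "measure lebesgue ?tri = c / 2"
  proof -
    have "{q0, q1, q2} = (+) q0 ` g ` insert 0 Basis"
      by (auto simp: Basis_vec2 g_def axis_def)
    then have "?tri = (+) q0 ` g ` (convex hull (insert 0 Basis))"
      by (simp only: convex_hull_translation convex_hull_linear_image lg)
    moreover have "compact (convex hull (insert 0 (Basis :: (real^2) set)))"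
      by (simp add: finite_imp_compact_convex_hull)
    ultimately show ?thesis
      using content_std_simplex[where 'a = "real^2"]
      by (simp add: measure_translation c(2) measure_lebesgue_eq_lborel)
  qed
  have "c \<noteq> 0" using simplex_over_measure_pos[OF over] vol by auto
  have "simplex_over ?K (SOME V :: ((real^2) \<times> 'e) set. simplex_over ?K V)"
    using over by (rule someI)
  from simplex_over_ratio_unique[OF lin this over, of x]
  have "simplex_spline TYPE('e) A ?K x =
      A * inverse (real ((DIM('e) + 2) choose 2)) * (measure lebesgue P / (c / fact (DIM('e) + 2)))"
    unfolding simplex_spline_def Let_def slice vol by simp
  \<comment> \<open>The factor \<open>(d+2)!\<close> cancels between the binomial coefficient and
    the volume of the simplex; the remaining \<open>2\<close> combines with \<open>c\<close> to the
    area \<open>c / 2\<close> of the base triangle.\<close>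
  also have "real ((DIM('e) + 2) choose 2) = fact (DIM('e) + 2) / (2 * fact DIM('e))"
    using binomial_fact[of 2 "DIM('e) + 2", where 'a = real] by simp
  finally have eq: "simplex_spline TYPE('e) A ?K x =
      A * inverse (fact (DIM('e) + 2) / (2 * fact DIM('e))) * (measure lebesgue P / (c / fact
          (DIM('e) + 2)))" .
  have alg: "A * inverse (n / (2 * f)) * (m / (c / n)) = A * f * m / (c / 2)" if "n \<noteq> 0" "f \<noteq> 0"
      for n f m :: real
    using that \<open>c \<noteq> 0\<close> by (simp add: field_simps)
  show "simplex_spline TYPE('e) A ?K x = A * fact DIM('e) * measure lebesgue P / measure lebesgue
      ?tri"
    unfolding eq tri by (rule alg) (rule fact_nonzero)+
qed

section \<open>Passing to coordinates on products of the real line\<close>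

lemma isometry_of_bases:
  fixes \<phi> :: "'c::euclidean_space \<Rightarrow> 'e::euclidean_space"
  assumes lin: "linear \<phi>" and bij: "bij_betw \<phi> Basis Basis" and i: "i \<in> Basis"
  shows "\<phi> u \<bullet> \<phi> i = u \<bullet> i"
proof -
  have "\<phi> u = (\<Sum>j\<in>Basis. (u \<bullet> j) *\<^sub>R \<phi> j)"
    by (subst euclidean_representation[of u, symmetric]) (simp add: linear_sum[OF lin]
        linear_scale[OF lin])
  then have "\<phi> u \<bullet> \<phi> i = (\<Sum>j\<in>Basis. (u \<bullet> j) * (\<phi> j \<bullet> \<phi> i))"
    by (simp add: inner_sum_left)
  also have "\<dots> = (\<Sum>j\<in>Basis. if j = i then u \<bullet> j else 0)"
  proof (intro sum.cong refl)
    fix j :: 'c assume j: "j \<in> Basis"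
    then have "\<phi> j \<in> Basis" "\<phi> i \<in> Basis" "\<phi> j = \<phi> i \<longleftrightarrow> j = i"
      using bij i by (auto simp: bij_betw_def inj_on_def)
    then show "(u \<bullet> j) * (\<phi> j \<bullet> \<phi> i) = (if j = i then u \<bullet> j else 0)"
      by (simp add: inner_Basis)
  qed
  finally show ?thesis using i by simp
qed

text \<open>Allows fibres to be measured in nested pairs of reals, where slicing can be iterated.
  Preimages of boxes are boxes with the same side lengths, and the values on boxes determine
  \<open>lborel\<close>; compactness survives because \<open>\<phi>\<close> preserves norms.\<close>

lemma measure_vimage_isometry:
  fixes \<phi> :: "'c::euclidean_space \<Rightarrow> 'e::euclidean_space"
  assumes lin: "linear \<phi>" and bij: "bij_betw \<phi> Basis Basis" and U: "compact U"
  shows "compact (\<phi> -` U)" and "measure lebesgue (\<phi> -` U) = measure lebesgue U"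
proof -
  note iso = isometry_of_bases[OF lin bij]
  have cont: "continuous_on A \<phi>" for A
    by (rule linear_continuous_on[OF linear_conv_bounded_linear[THEN iffD1, OF lin]])
  have [measurable]: "\<phi> \<in> borel_measurable borel"
    by (rule borel_measurable_continuous_onI[OF cont])
  have Basis: "Basis = \<phi> ` Basis" using bij by (simp add: bij_betw_def)
  have "lborel = distr lborel borel \<phi>"
  proof (rule lborel_eqI)
    fix l u :: 'e
    assume lu: "\<And>b. b \<in> Basis \<Longrightarrow> l \<bullet> b \<le> u \<bullet> b"
    define l' u' where "l' = (\<Sum>i\<in>Basis. (l \<bullet> \<phi> i) *\<^sub>R i)" and "u' = (\<Sum>i\<in>Basis. (u \<bullet> \<phi> i) *\<^sub>R i)"
    have b: "l' \<bullet> i = l \<bullet> \<phi> i" "u' \<bullet> i = u \<bullet> \<phi> i" if "i \<in> Basis" for i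
      using that by (simp_all add: l'_def u'_def)
    have "\<phi> -` box l u = box l' u'"
    proof -
      have "\<phi> x \<in> box l u \<longleftrightarrow> x \<in> box l' u'" for x
        unfolding mem_box by (subst Basis) (simp add: b iso)
      then show ?thesis by auto
    qed
    then have "emeasure (distr lborel borel \<phi>) (box l u) = emeasure lborel (box l' u')"
      by (simp add: emeasure_distr)
    also have "\<dots> = ennreal (\<Prod>i\<in>Basis. (u' - l') \<bullet> i)"
      using lu Basis by (subst emeasure_lborel_box) (auto simp: b)
    also have "(\<Prod>i\<in>Basis. (u' - l') \<bullet> i) = (\<Prod>b\<in>Basis. (u - l) \<bullet> b)"
      using bij by (subst prod.reindex_bij_betw[OF bij, symmetric]) (simp add: b inner_diff_left)
    finally show "emeasure (distr lborel borel \<phi>) (box l u) = ennreal (\<Prod>b\<in>Basis. (u - l) \<bullet> b)"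
      by simp
  qed simp
  from arg_cong[OF this, of "\<lambda>M. emeasure M U"]
  have "emeasure lborel U = emeasure lborel (\<phi> -` U)"
    by (simp add: emeasure_distr borel_compact U)
  moreover show cpt: "compact (\<phi> -` U)"
  proof -
    have "norm (\<phi> u) = norm u" for u
    proof -
      have "\<phi> u \<bullet> \<phi> u = (\<Sum>b\<in>Basis. (\<phi> u \<bullet> b) * (\<phi> u \<bullet> b))"
        by (rule euclidean_inner)
      also have "\<dots> = (\<Sum>i\<in>Basis. (u \<bullet> i) * (u \<bullet> i))"
        by (subst sum.reindex_bij_betw[OF bij, symmetric]) (simp add: iso)
      also have "\<dots> = u \<bullet> u"
        by (rule euclidean_inner[symmetric])
      finally show ?thesis by (simp add: norm_eq_sqrt_inner)
    qed
    then have "bounded (\<phi> -` U)"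
      using compact_imp_bounded[OF U] unfolding bounded_iff by (metis vimage_eq)
    moreover have "closed (\<phi> -` U)"
      using compact_imp_closed[OF U] cont by (simp add: closed_vimage)
    ultimately show ?thesis by (simp add: compact_eq_bounded_closed)
  qed
  ultimately show "measure lebesgue (\<phi> -` U) = measure lebesgue U"
    by (simp add: emeasure_lborel_compact U)
qed

text \<open>Comparing barycentric coordinates turns the vector equation over \<open>x\<close> into
  three scalar equations. These determine the base weights as slacks, and nonnegativity of the
  slacks is what the three inequalities in \<open>P\<close> express.\<close>

lemma simplex_spline_barycentric:
  fixes k :: "'c::euclidean_space \<Rightarrow> real^2" and \<phi> :: "'c \<Rightarrow> 'e::euclidean_space"
  assumes lin: "linear_maps_scale_measure TYPE('e)"
    and \<phi>: "linear \<phi>" "bij_betw \<phi> Basis Basis"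
    and nc: "\<not> collinear {q0, q1, q2}"
    and x: "x = b0 *\<^sub>R q0 + b1 *\<^sub>R q1 + b2 *\<^sub>R q2" "b0 + b1 + b2 = 1"
    and k: "\<And>i. i \<in> Basis \<Longrightarrow> k i = k0 i *\<^sub>R q0 + k1 i *\<^sub>R q1 + k2 i *\<^sub>R q2"
      "\<And>i. i \<in> Basis \<Longrightarrow> k0 i + k1 i + k2 i = 1"
  defines "P \<equiv> {u :: 'c. (\<forall>i\<in>Basis. 0 \<le> u \<bullet> i) \<and> (\<Sum>i\<in>Basis. (u \<bullet> i) * k0 i) \<le> b0 \<and>
    (\<Sum>i\<in>Basis. (u \<bullet> i) * k1 i) \<le> b1 \<and> (\<Sum>i\<in>Basis. (u \<bullet> i) * k2 i) \<le> b2}"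
  shows "compact P"
    and "simplex_spline TYPE('e) A ({#q0, q1, q2#} + image_mset k (mset_set Basis)) x =
      A * fact DIM('c) * measure lebesgue P / measure lebesgue (convex hull {q0, q1, q2})"
proof -
  note iso = isometry_of_bases[OF \<phi>]
  have inj: "inj_on \<phi> Basis" and Basis: "Basis = \<phi> ` Basis" using \<phi>(2) by (auto simp: bij_betw_def)
  have DIM: "DIM('e) = DIM('c)" by (subst Basis) (simp add: card_image inj)
  define k' where "k' j = k (inv_into Basis \<phi> j)" for j
  have k': "k' (\<phi> i) = k i" if "i \<in> Basis" for i using that inj by (simp add: k'_def)
  have "image_mset k (mset_set Basis) = image_mset (k' \<circ> \<phi>) (mset_set Basis)"
    by (intro image_mset_cong) (simp add: k')
  also have "\<dots> = image_mset k' (mset_set Basis)"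
    using image_mset_mset_set[OF inj] Basis by (simp flip: multiset.map_comp)
  finally have ms: "image_mset k (mset_set Basis) = image_mset k' (mset_set Basis)" .
  let ?P = "{u. (\<forall>i\<in>Basis. 0 \<le> u \<bullet> i) \<and>
      (\<exists>l0 l1 l2. 0 \<le> l0 \<and> 0 \<le> l1 \<and> 0 \<le> l2 \<and> l0 + l1 + l2 + (\<Sum>i\<in>Basis. u \<bullet> i) = 1 \<and>
        l0 *\<^sub>R q0 + l1 *\<^sub>R q1 + l2 *\<^sub>R q2 + (\<Sum>i\<in>Basis. (u \<bullet> i) *\<^sub>R k' i) = x)}"
  have "\<phi> -` ?P = P"
  proof -
    have "\<phi> u \<in> ?P \<longleftrightarrow> u \<in> P" for u
    proof -
      define s where "s f = (\<Sum>i\<in>Basis. (u \<bullet> i) * f i)" for f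
      have "(\<Sum>i\<in>Basis. u \<bullet> i) = (\<Sum>i\<in>Basis. (u \<bullet> i) * (k0 i + k1 i + k2 i))"
        using k(2) by simp
      then have s1: "(\<Sum>i\<in>Basis. u \<bullet> i) = s k0 + s k1 + s k2"
        by (simp add: s_def algebra_simps sum.distrib)
      have "(\<Sum>i\<in>Basis. (u \<bullet> i) *\<^sub>R k i)
          = (\<Sum>i\<in>Basis. (u \<bullet> i) *\<^sub>R (k0 i *\<^sub>R q0 + k1 i *\<^sub>R q1 + k2 i *\<^sub>R q2))"
        using k(1) by simp
      then have sk: "(\<Sum>i\<in>Basis. (u \<bullet> i) *\<^sub>R k i) = s k0 *\<^sub>R q0 + s k1 *\<^sub>R q1 + s k2 *\<^sub>R q2"
        by (simp add: s_def scaleR_add_right sum.distrib scaleR_sum_left)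
      have e1: "(\<forall>j\<in>Basis. 0 \<le> \<phi> u \<bullet> j) \<longleftrightarrow> (\<forall>i\<in>Basis. 0 \<le> u \<bullet> i)"
        by (subst Basis) (simp add: iso)
      have e2: "(\<Sum>j\<in>Basis. \<phi> u \<bullet> j) = (\<Sum>i\<in>Basis. u \<bullet> i)"
        by (subst sum.reindex_bij_betw[OF \<phi>(2), symmetric]) (simp add: iso)
      have e3: "(\<Sum>j\<in>Basis. (\<phi> u \<bullet> j) *\<^sub>R k' j) = (\<Sum>i\<in>Basis. (u \<bullet> i) *\<^sub>R k i)"
        by (subst sum.reindex_bij_betw[OF \<phi>(2), symmetric]) (simp add: iso k')
      have "\<phi> u \<in> ?P \<longleftrightarrow> (\<forall>i\<in>Basis. 0 \<le> u \<bullet> i) \<and>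
        (\<exists>l0 l1 l2. 0 \<le> l0 \<and> 0 \<le> l1 \<and> 0 \<le> l2 \<and> l0 + l1 + l2 + (s k0 + s k1 + s k2) = 1 \<and>
          l0 *\<^sub>R q0 + l1 *\<^sub>R q1 + l2 *\<^sub>R q2 + (s k0 *\<^sub>R q0 + s k1 *\<^sub>R q1 + s k2 *\<^sub>R q2) = x)"
        unfolding mem_Collect_eq e1 e2 e3 s1 sk ..
      also have "\<dots> \<longleftrightarrow> (\<forall>i\<in>Basis. 0 \<le> u \<bullet> i) \<and>
        (\<exists>l0 l1 l2. 0 \<le> l0 \<and> 0 \<le> l1 \<and> 0 \<le> l2 \<and> l0 + s k0 = b0 \<and> l1 + s k1 = b1 \<and> l2 + s k2 = b2)"
      proof -
        \<comment> \<open>From left to right, the sum of all weights provides the equal totals that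
          uniqueness of coordinates requires; from right to left, that sum is recovered from
          \<open>b0 + b1 + b2 = 1\<close>.\<close>
        have "l0 + l1 + l2 + (s k0 + s k1 + s k2) = 1 \<and>
          l0 *\<^sub>R q0 + l1 *\<^sub>R q1 + l2 *\<^sub>R q2 + (s k0 *\<^sub>R q0 + s k1 *\<^sub>R q1 + s k2 *\<^sub>R q2) = x
          \<longleftrightarrow> l0 + s k0 = b0 \<and> l1 + s k1 = b1 \<and> l2 + s k2 = b2" (is "?s \<and> ?e \<longleftrightarrow> ?r") for l0 l1 l2
        proof -
          have "?e \<longleftrightarrow> (l0 + s k0) *\<^sub>R q0 + (l1 + s k1) *\<^sub>R q1 + (l2 + s k2) *\<^sub>R q2
            = b0 *\<^sub>R q0 + b1 *\<^sub>R q1 + b2 *\<^sub>R q2"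
            by (simp add: x(1) algebra_simps)
          then have "?s \<Longrightarrow> ?e \<longleftrightarrow> ?r"
            using barycentric_unique[OF nc, of "l0 + s k0" "l1 + s k1" "l2 + s k2" b0 b1 b2] x(2)
                by simp
          moreover have "?r \<Longrightarrow> ?s" using x(2) by linarith
          ultimately show ?thesis by blast
        qed
        then show ?thesis by simp
      qed
      also have "\<dots> \<longleftrightarrow> u \<in> P"
      proof -
        have "(\<exists>l0 l1 l2. 0 \<le> l0 \<and> 0 \<le> l1 \<and> 0 \<le> l2 \<and> l0 + s k0 = b0 \<and> l1 + s k1 = b1
            \<and> l2 + s k2 = b2)
          \<longleftrightarrow> s k0 \<le> b0 \<and> s k1 \<le> b1 \<and> s k2 \<le> b2" (is "?l \<longleftrightarrow> ?r")
        proof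
          assume ?r
          then show ?l
            by (intro exI[of _ "b0 - s k0"] exI[of _ "b1 - s k1"] exI[of _ "b2 - s k2"]) auto
        qed auto
        then show ?thesis by (simp add: P_def s_def)
      qed
      finally show ?thesis .
    qed
    then show ?thesis by auto
  qed
  with simplex_spline_eq[OF lin nc, where k = k' and x = x] measure_vimage_isometry[OF \<phi>, of ?P]
  show "compact P"
    and "simplex_spline TYPE('e) A ({#q0, q1, q2#} + image_mset k (mset_set Basis)) x =
      A * fact DIM('c) * measure lebesgue P / measure lebesgue (convex hull {q0, q1, q2})"
    by (simp_all only: ms DIM)
qed

section \<open>Fibres in dimensions one, two and three\<close>

lemma simplex_spline_real:
  fixes x :: "real^2"
  assumes nc: "\<not> collinear {q0, q1, q2}"
    and x: "x = b0 *\<^sub>R q0 + b1 *\<^sub>R q1 + b2 *\<^sub>R q2" "b0 + b1 + b2 = 1"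
    and r: "r = r0 *\<^sub>R q0 + r1 *\<^sub>R q1 + r2 *\<^sub>R q2" "r0 + r1 + r2 = 1"
  shows "simplex_spline TYPE(real) A {#q0, q1, q2, r#} x =
    A / measure lebesgue (convex hull {q0, q1, q2}) *
      measure lebesgue {u. 0 \<le> u \<and> u * r0 \<le> b0 \<and> u * r1 \<le> b1 \<and> u * r2 \<le> b2}"
  \<comment> \<open>The only basis vector of \<open>real\<close> is \<open>1\<close>, where scaling
    by \<open>i\<close> returns \<open>r\<close> and its coordinates.\<close>
  using simplex_spline_barycentric(2)[OF linear_maps_scale_measure_real, where \<phi> = "\<lambda>u::real. u"
      and k = "\<lambda>i. i *\<^sub>R r" and ?k0.0 = "\<lambda>i. i * r0" and ?k1.0 = "\<lambda>i. i * r1"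
          and ?k2.0 = "\<lambda>i. i * r2",
      OF linear_ident _ nc x, of A] r
  by (simp add: bij_betw_def add_mset_commute)

lemma Basis_real_real: "(Basis :: (real \<times> real) set) = {(1, 0), (0, 1)}"
  by (auto simp: Basis_prod_def zero_prod_def)

lemma Basis_real_real_real: "(Basis :: (real \<times> real \<times> real) set) = {(1, 0, 0), (0, 1, 0), (0, 0,
    1)}"
  by (auto simp: Basis_prod_def zero_prod_def)

lemma Basis_vec3: "(Basis :: (real^3) set) = {axis 1 1, axis 2 1, axis 3 1}"
  by (auto simp: Basis_vec_def UNIV_3)

lemma simplex_spline_vec2:
  fixes x :: "real^2"
  assumes nc: "\<not> collinear {q0, q1, q2}"
    and x: "x = b0 *\<^sub>R q0 + b1 *\<^sub>R q1 + b2 *\<^sub>R q2" "b0 + b1 + b2 = 1"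
    and r: "r = r0 *\<^sub>R q0 + r1 *\<^sub>R q1 + r2 *\<^sub>R q2" "r0 + r1 + r2 = 1"
    and s: "s = m0 *\<^sub>R q0 + m1 *\<^sub>R q1 + m2 *\<^sub>R q2" "m0 + m1 + m2 = 1"
  defines "P \<equiv> {(u, v). 0 \<le> u \<and> 0 \<le> v \<and> u * r0 + v * m0 \<le> b0 \<and> u * r1 + v * m1 \<le> b1 \<and>
    u * r2 + v * m2 \<le> b2}"
  shows "compact P"
    and "simplex_spline TYPE(real^2) A {#q0, q1, q2, r, s#} x =
      2 * A / measure lebesgue (convex hull {q0, q1, q2}) * measure lebesgue P"
proof -
  define \<phi> :: "real \<times> real \<Rightarrow> real^2" where "\<phi> = (\<lambda>(u, v). vector [u, v])"
  have "linear \<phi>"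
    by (intro linearI) (auto simp: \<phi>_def vec_eq_iff forall_2)
  moreover have "\<phi> (1, 0) = axis 1 1" "\<phi> (0, 1) = axis 2 1"
    by (auto simp: \<phi>_def vec_eq_iff forall_2 axis_def)
  then have "bij_betw \<phi> Basis Basis"
    by (auto simp: bij_betw_def Basis_real_real Basis_vec2 axis_eq_axis)
  \<comment> \<open>A basis vector has one component \<open>1\<close> and the other
    \<open>0\<close>, so \<open>fst i\<close> and \<open>snd i\<close> select the knot assigned to
    \<open>i\<close>.\<close>
  moreover have k: "fst i *\<^sub>R r + snd i *\<^sub>R s = (fst i * r0 + snd i * m0) *\<^sub>R q0 +
      (fst i * r1 + snd i * m1) *\<^sub>R q1 + (fst i * r2 + snd i * m2) *\<^sub>R q2"
    "(fst i * r0 + snd i * m0) + (fst i * r1 + snd i * m1) + (fst i * r2 + snd i * m2) = 1"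
    if "i \<in> Basis" for i :: "real \<times> real"
    using that r s by (auto simp: Basis_real_real)
  moreover have "P = {u. (\<forall>i\<in>Basis. 0 \<le> u \<bullet> i) \<and>
      (\<Sum>i\<in>Basis. (u \<bullet> i) * (fst i * r0 + snd i * m0)) \<le> b0 \<and>
      (\<Sum>i\<in>Basis. (u \<bullet> i) * (fst i * r1 + snd i * m1)) \<le> b1 \<and>
      (\<Sum>i\<in>Basis. (u \<bullet> i) * (fst i * r2 + snd i * m2)) \<le> b2}"
    by (auto simp: P_def Basis_real_real)
  moreover have "{#q0, q1, q2#} + image_mset (\<lambda>i. fst i *\<^sub>R r + snd i *\<^sub>R s) (mset_set Basis)
      = {#q0, q1, q2, r, s#}"
    by (simp add: Basis_real_real add_mset_commute)
  moreover note simplex_spline_barycentric[OF linear_maps_scale_measure_vec[where 'n =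
      2] _ _ nc x, of \<phi>,
      where k = "\<lambda>i. fst i *\<^sub>R r + snd i *\<^sub>R s" and ?k0.0 = "\<lambda>i. fst i * r0 + snd i * m0"
      and ?k1.0 = "\<lambda>i. fst i * r1 + snd i * m1" and ?k2.0 = "\<lambda>i. fst i * r2 + snd i * m2"]
  ultimately show "compact P"
    and "simplex_spline TYPE(real^2) A {#q0, q1, q2, r, s#} x =
      2 * A / measure lebesgue (convex hull {q0, q1, q2}) * measure lebesgue P"
    by (simp_all add: add_mset_commute mult.commute)
qed

lemma simplex_spline_vec3:
  fixes x :: "real^2"
  assumes nc: "\<not> collinear {q0, q1, q2}"
    and x: "x = b0 *\<^sub>R q0 + b1 *\<^sub>R q1 + b2 *\<^sub>R q2" "b0 + b1 + b2 = 1"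
    and r: "r = r0 *\<^sub>R q0 + r1 *\<^sub>R q1 + r2 *\<^sub>R q2" "r0 + r1 + r2 = 1"
    and s: "s = m0 *\<^sub>R q0 + m1 *\<^sub>R q1 + m2 *\<^sub>R q2" "m0 + m1 + m2 = 1"
    and t: "t = t0 *\<^sub>R q0 + t1 *\<^sub>R q1 + t2 *\<^sub>R q2" "t0 + t1 + t2 = 1"
  defines "P \<equiv> {(u, v, w). 0 \<le> u \<and> 0 \<le> v \<and> 0 \<le> w \<and> u * r0 + v * m0 + w * t0 \<le> b0 \<and>
    u * r1 + v * m1 + w * t1 \<le> b1 \<and> u * r2 + v * m2 + w * t2 \<le> b2}"
  shows "compact P"
    and "simplex_spline TYPE(real^3) A {#q0, q1, q2, r, s, t#} x =
      6 * A / measure lebesgue (convex hull {q0, q1, q2}) * measure lebesgue P"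
proof -
  define \<phi> :: "real \<times> real \<times> real \<Rightarrow> real^3" where "\<phi> = (\<lambda>(u, v, w). vector [u, v, w])"
  have "linear \<phi>"
    by (intro linearI) (auto simp: \<phi>_def vec_eq_iff forall_3)
  moreover have "\<phi> (1, 0, 0) = axis 1 1" "\<phi> (0, 1, 0) = axis 2 1" "\<phi> (0, 0, 1) = axis 3 1"
    by (auto simp: \<phi>_def vec_eq_iff forall_3 axis_def)
  then have "bij_betw \<phi> Basis Basis"
    by (auto simp: bij_betw_def Basis_real_real_real Basis_vec3 axis_eq_axis)
  moreover have k: "fst i *\<^sub>R r + fst (snd i) *\<^sub>R s + snd (snd i) *\<^sub>R t = (fst i * r0
      + fst (snd i) * m0 + snd (snd i) * t0) *\<^sub>R q0 +
      (fst i * r1 + fst (snd i) * m1 + snd (snd i) * t1) *\<^sub>R q1 + (fst i * r2 + fst (snd i) * m2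
          + snd (snd i) * t2) *\<^sub>R q2"
    "(fst i * r0 + fst (snd i) * m0 + snd (snd i) * t0) + (fst i * r1 + fst (snd i) * m1
        + snd (snd i) * t1) +
      (fst i * r2 + fst (snd i) * m2 + snd (snd i) * t2) = 1"
    if "i \<in> Basis" for i :: "real \<times> real \<times> real"
    using that r s t by (auto simp: Basis_real_real_real)
  moreover have "P = {u. (\<forall>i\<in>Basis. 0 \<le> u \<bullet> i) \<and>
      (\<Sum>i\<in>Basis. (u \<bullet> i) * (fst i * r0 + fst (snd i) * m0 + snd (snd i) * t0)) \<le> b0 \<and>
      (\<Sum>i\<in>Basis. (u \<bullet> i) * (fst i * r1 + fst (snd i) * m1 + snd (snd i) * t1)) \<le> b1 \<and>
      (\<Sum>i\<in>Basis. (u \<bullet> i) * (fst i * r2 + fst (snd i) * m2 + snd (snd i) * t2)) \<le> b2}"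
    by (auto simp: P_def Basis_real_real_real add_ac)
  moreover have "{#q0, q1, q2#} +
      image_mset (\<lambda>i. fst i *\<^sub>R r + fst (snd i) *\<^sub>R s + snd (snd i) *\<^sub>R t) (mset_set Basis)
      = {#q0, q1, q2, r, s, t#}"
    by (simp add: Basis_real_real_real add_mset_commute)
  moreover note simplex_spline_barycentric[OF linear_maps_scale_measure_vec[where 'n =
      3] _ _ nc x, of \<phi>,
      where k = "\<lambda>i. fst i *\<^sub>R r + fst (snd i) *\<^sub>R s + snd (snd i) *\<^sub>R t"
      and ?k0.0 = "\<lambda>i. fst i * r0 + fst (snd i) * m0 + snd (snd i) * t0"
      and ?k1.0 = "\<lambda>i. fst i * r1 + fst (snd i) * m1 + snd (snd i) * t1"
      and ?k2.0 = "\<lambda>i. fst i * r2 + fst (snd i) * m2 + snd (snd i) * t2"]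
  ultimately show "compact P"
    and "simplex_spline TYPE(real^3) A {#q0, q1, q2, r, s, t#} x =
      6 * A / measure lebesgue (convex hull {q0, q1, q2}) * measure lebesgue P"
    by (simp_all add: fact_numeral add_mset_commute mult.commute)
qed

section \<open>Areas of triangles\<close>

lemma measure_triangle_pos:
  fixes a b c :: "real^2"
  assumes "\<not> collinear {a, b, c}"
  shows "measure lebesgue (convex hull {a, b, c}) > 0"
proof -
  have "a \<noteq> b" "a \<noteq> c" "b \<noteq> c" "\<not> affine_dependent {a, b, c}"
    using assms by (auto simp: collinear_3_eq_affine_dependent insert_commute)
  then have "interior (convex hull {a, b, c}) \<noteq> {}"
    using interior_convex_hull_eq_empty[of "{a, b, c}"] by simp
  then have "\<not> negligible (convex hull {a, b, c})"
    using negligible_convex_interior convex_convex_hull by blast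
  moreover have "convex hull {a, b, c} \<in> lmeasurable"
    by (simp add: lmeasurable_compact finite_imp_compact_convex_hull)
  ultimately show ?thesis
    by (metis less_eq_real_def measure_nonneg negligible_iff_measure0)
qed

lemma measure_triangle:
  fixes a b c :: "real^2"
  shows "measure lebesgue (convex hull {a, b, c}) =
    \<bar>(c $ 1 - a $ 1) * (b $ 2 - a $ 2) - (b $ 1 - a $ 1) * (c $ 2 - a $ 2)\<bar> / 2"
  using content_triangle[of a b c]
  by (simp add: measure_lebesgue_eq_lborel finite_imp_compact_convex_hull)

lemma measure_triangle_collinear:
  fixes a b c :: "real^2"
  assumes "collinear {a, b, c}"
  shows "measure lebesgue (convex hull {a, b, c}) = 0"
proof (cases "a = c")
  case False
  then obtain u where b: "b = u *\<^sub>R a + (1 - u) *\<^sub>R c"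
    using assms collinear_3_expand by blast
  show ?thesis unfolding measure_triangle b by (simp add: algebra_simps)
qed (simp add: measure_triangle)

text \<open>The factor is the determinant of the three rows of barycentric coordinates. After
  \<open>t0\<close>, \<open>t1\<close>, \<open>t2\<close> are eliminated, its product with the
  signed area of the large triangle is a polynomial identity.\<close>

lemma measure_subtriangle:
  fixes a b c :: "real^2"
  assumes q: "q0 = r0 *\<^sub>R a + m0 *\<^sub>R b + t0 *\<^sub>R c" "q1 = r1 *\<^sub>R a + m1 *\<^sub>R b + t1 *\<^sub>R c"
      "q2 = r2 *\<^sub>R a + m2 *\<^sub>R b + t2 *\<^sub>R c"
    and t: "r0 + m0 + t0 = 1" "r1 + m1 + t1 = 1" "r2 + m2 + t2 = 1"
  shows "measure lebesgue (convex hull {q0, q1, q2}) =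
    \<bar>r0 * (m1 * t2 - m2 * t1) - m0 * (r1 * t2 - r2 * t1) + t0 * (r1 * m2 - r2 * m1)\<bar> *
      measure lebesgue (convex hull {a, b, c})"
proof -
  have t': "t0 = 1 - r0 - m0" "t1 = 1 - r1 - m1" "t2 = 1 - r2 - m2" using t by auto
  show ?thesis
    unfolding measure_triangle q t' times_divide_eq_right abs_mult[symmetric]
    by (intro arg_cong[of _ _ "\<lambda>z. \<bar>z\<bar> / 2"]) (simp, algebra)
qed

section \<open>Areas and volumes of the fibres\<close>

text \<open>The form in which Tonelli's theorem is applied to every fibre. The slice formula
  \<open>g\<close> has to hold only on the range of the outer coordinate, so simplifications valid
  just there may be used.\<close>

lemma measure_by_slices:
  fixes U :: "(real \<times> 'b::euclidean_space) set"
  assumes U: "compact U"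
    and slice: "\<And>t. a \<le> t \<Longrightarrow> t \<le> b \<Longrightarrow> measure lebesgue {z. (t, z) \<in> U} = g t"
    and empty: "\<And>t z. (t, z) \<in> U \<Longrightarrow> a \<le> t \<and> t \<le> b"
    and int: "(g has_integral I) {a..b}"
  shows "measure lebesgue U = I"
proof -
  let ?m = "\<lambda>t. measure lebesgue {z. (t, z) \<in> U}"
  have "?m t = (if t \<in> {a..b} then g t else 0)" for t
  proof (cases "t \<in> {a..b}")
    case False
    then have "{z. (t, z) \<in> U} = {}" using empty by auto
    then show ?thesis using False by (auto simp del: Collect_empty_eq)
  qed (simp add: slice)
  then have "(?m has_integral I) UNIV"
    using int has_integral_restrict_UNIV[of "{a..b}" g I] by presburger
  then have "(\<integral>\<^sup>+t. ennreal (?m t) \<partial>lborel) = ennreal I"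
    using measurable_slices_snd[OF U] by (intro nn_integral_has_integral_lborel) auto
  moreover have "0 \<le> I"
    using \<open>(?m has_integral I) UNIV\<close> by (rule has_integral_nonneg) simp
  ultimately show ?thesis
    using emeasure_slices_snd[OF U] emeasure_lborel_compact[OF U] by (simp add: ennreal_inj)
qed

lemma has_field_derivative_max0_power:
  assumes "0 < n"
  shows "((\<lambda>u::real. max 0 u ^ Suc n) has_field_derivative real (Suc n) * max 0 u ^ n) (at u)"
proof (cases u "0::real" rule: linorder_cases)
  case less
  have "((\<lambda>_. 0) has_field_derivative real (Suc n) * max 0 u ^ n) (at u)"
    using less assms by (auto intro!: derivative_eq_intros)
  then show ?thesis
    by (rule has_field_derivative_transform_within_open[of _ _ _ "{..<0}"]) (use less in auto)
next
  case equal
  \<comment> \<open>At the kink Caratheodory's form of the derivative applies: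
    \<open>max 0 z ^ Suc n = max 0 z ^ n * z\<close>, and the first factor is continuous and, as
    \<open>0 < n\<close>, vanishes at \<open>0\<close>.\<close>
  have "isCont (\<lambda>z::real. max 0 z ^ n) 0" by (intro continuous_intros)
  then show ?thesis
    unfolding equal CARAT_DERIV
    by (intro exI[of _ "\<lambda>z. max 0 z ^ n"]) (use assms in \<open>auto simp: max_def zero_power\<close>)
next
  case greater
  have "((\<lambda>u. u ^ Suc n) has_field_derivative real (Suc n) * max 0 u ^ n) (at u)"
    using DERIV_pow[of "Suc n" u UNIV] greater by (simp add: max_def del: power_Suc)
  then show ?thesis
    by (rule has_field_derivative_transform_within_open[of _ _ _ "{0<..}"]) (use greater in \<open>auto
        simp: max_def\<close>)
qed

lemma has_integral_max0_linear_power: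
  assumes "0 < n" "a \<le> b" "m \<noteq> 0"
  shows "((\<lambda>t::real. max 0 (c + m * t) ^ n) has_integral
    (max 0 (c + m * b) ^ Suc n - max 0 (c + m * a) ^ Suc n) / (m * real (Suc n))) {a..b}"
proof -
  have "((\<lambda>t. max 0 (c + m * t) ^ Suc n / (m * real (Suc n))) has_field_derivative max 0 (c
      + m * t) ^ n) (at t within {a..b})" for t
  proof -
    have "((\<lambda>t. max 0 (c + m * t) ^ Suc n) has_field_derivative (real (Suc n) * max 0 (c
        + m * t) ^ n) * m) (at t)"
      by (rule DERIV_chain2[OF has_field_derivative_max0_power[OF assms(1)]])
        (auto intro!: derivative_eq_intros)
    from DERIV_cdivide[OF this, of "m * real (Suc n)"] show ?thesis
      using assms by (auto intro: DERIV_subset simp del: of_nat_Suc power_Suc)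
  qed
  then have "((\<lambda>t. max 0 (c + m * t) ^ n) has_integral
    (max 0 (c + m * b) ^ Suc n / (m * real (Suc n)) - max 0 (c
        + m * a) ^ Suc n / (m * real (Suc n)))) {a..b}"
    by (intro fundamental_theorem_of_calculus assms(2)) (auto
        simp: has_real_derivative_iff_has_vector_derivative simp del: power_Suc)
  then show ?thesis by (simp add: diff_divide_distrib del: power_Suc)
qed

lemma has_integral_max0_linear:
  assumes "0 \<le> b" "m \<noteq> 0"
  shows "((\<lambda>t::real. max 0 (c + m * t)) has_integral (max 0 (c + m * b) ^ 2
      - max 0 c ^ 2) / (2 * m)) {0..b}"
  using has_integral_max0_linear_power[of 1 0 b m c] assms
      by (simp add: numeral_2_eq_2 mult.commute)

lemma has_integral_max0_linear_square:
  assumes "0 \<le> b" "m \<noteq> 0"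
  shows "((\<lambda>t::real. max 0 (c + m * t) ^ 2) has_integral (max 0 (c + m * b) ^ 3
      - max 0 c ^ 3) / (3 * m)) {0..b}"
  using has_integral_max0_linear_power[of 2 0 b m c] assms
      by (simp add: numeral_3_eq_3 mult.commute)

lemma max0_double: "max 0 (2 * z) = 2 * max 0 (z::real)"
  by (simp add: max_def)

section \<open>Lengths and areas of fibres\<close>

lemma length_interval: "measure lebesgue {u::real. l \<le> u \<and> u \<le> c} = max 0 (c - l)"
proof -
  have "{u::real. l \<le> u \<and> u \<le> c} = {l..c}" by auto
  then show ?thesis by (auto simp: max_def)
qed

lemma area_box:
  assumes c: "compact U" and U: "U = {(u::real, v::real). 0 \<le> u \<and> u \<le> p \<and> 0 \<le> v \<and> v \<le> q}"
    and "0 \<le> p" "0 \<le> q"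
  shows "measure lebesgue U = p * q"
proof (rule measure_by_slices[OF c, of 0 p "\<lambda>_. q"])
  show "((\<lambda>_. q) has_integral p * q) {0..p}"
    using has_integral_const_real[of q 0 p] assms by simp
qed (use assms in \<open>auto simp: length_interval\<close>)

text \<open>Inclusion-exclusion in the triangle \<open>u + v \<le> s\<close>: the parts beyond
  \<open>u = p\<close> and \<open>v = q\<close> are triangles of sizes \<open>s - p\<close> and
  \<open>s - q\<close>, and the last term restores their overlap.\<close>

lemma area_pentagon:
  assumes c: "compact U" and U: "U = {(u::real, v::real). 0 \<le> u \<and> u \<le> p \<and> 0 \<le> v \<and> v \<le> q
      \<and> u + v \<le> s}"
    and p: "0 \<le> p" and q: "0 \<le> q"
  shows "measure lebesgue U = (max 0 s ^ 2 - max 0 (s - p) ^ 2 - max 0 (s - q) ^ 2 + max 0 (s - p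
      - q) ^ 2) / 2"
proof (rule measure_by_slices[OF c, of 0 p])
  fix t assume t: "0 \<le> t" "t \<le> p"
  then have "{v. (t, v) \<in> U} = {v. 0 \<le> v \<and> v \<le> min q (s - t)}" by (auto simp: U)
  \<comment> \<open>The coefficient of \<open>t\<close> is kept explicit so that the integral
    formula for \<open>max 0 (c + m * t)\<close> matches.\<close>
  then show "measure lebesgue {v. (t, v) \<in> U} = max 0 (s + (-1) * t) - max 0 (s - q + (-1) * t)"
    unfolding \<open>{v. (t, v) \<in> U} = _\<close> length_interval using q by (simp add: max_def min_def)
next
  show "((\<lambda>t. max 0 (s + (-1) * t) - max 0 (s - q + (-1) * t)) has_integral
    (max 0 s ^ 2 - max 0 (s - p) ^ 2 - max 0 (s - q) ^ 2 + max 0 (s - p - q) ^ 2) / 2) {0..p}"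
    by (rule has_integral_eq_rhs[OF has_integral_diff[OF
          has_integral_max0_linear[OF p] has_integral_max0_linear[OF p]]]) (auto simp: field_simps)
qed (auto simp: U)

lemma area_triangle_corner:
  assumes c: "compact U" and U: "U = {(u::real, v::real). 0 \<le> u \<and> 0 \<le> v \<and> u + v \<le> s}"
  shows "measure lebesgue U = max 0 s ^ 2 / 2"
proof (cases "0 \<le> s")
  case True
  have "U = {(u, v). 0 \<le> u \<and> u \<le> s \<and> 0 \<le> v \<and> v \<le> s \<and> u + v \<le> s}" by (auto simp: U)
  from area_pentagon[OF c this] True show ?thesis by simp
next
  case False
  then have "U = {}" by (auto simp: U)
  then show ?thesis using False by (simp only: measure_empty) simp
qed

text \<open>For \<open>a \<ge> 0\<close> the triangle \<open>u + w / 2 \<le> a\<close> has area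
  \<open>a ^ 2\<close>; the bound on \<open>w\<close> removes the similar triangle with
  \<open>a - b\<close> in place of \<open>a\<close>.\<close>

lemma area_trapezoid:
  assumes c: "compact U" and U: "U = {(w::real, u::real). 0 \<le> w \<and> 0 \<le> u \<and> u + w / 2 \<le> a
      \<and> w / 2 \<le> b}"
    and b: "0 \<le> b"
  shows "measure lebesgue U = max 0 a ^ 2 - max 0 (a - b) ^ 2"
proof (rule measure_by_slices[OF c, of 0 "2 * b"])
  fix t assume t: "0 \<le> t" "t \<le> 2 * b"
  then have "{v. (t, v) \<in> U} = {v. 0 \<le> v \<and> v \<le> a - t / 2}" by (auto simp: U)
  then show "measure lebesgue {v. (t, v) \<in> U} = max 0 (a + (-1/2) * t)"
    by (simp add: length_interval)
next
  show "((\<lambda>t. max 0 (a + (-1/2) * t)) has_integral max 0 a ^ 2 - max 0 (a - b) ^ 2) {0..2 * b}"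
    by (rule has_integral_eq_rhs[OF has_integral_max0_linear]) (use b in auto)
qed (auto simp: U)

text \<open>Splits a truncated minimum into truncations that can be integrated one by one. The
  hypothesis excludes two negative arguments: if \<open>B < 0\<close> then \<open>A > 0\<close>, and
  the right side collapses to \<open>0\<close>.\<close>

lemma max0_min_linear:
  assumes "0 \<le> A + (B::real)"
  shows "max 0 (min A B) = max 0 A - max 0 (A - B) + max 0 (- B)"
  using assms by (auto simp: max_def min_def)

text \<open>At fixed \<open>v\<close> the upper bounds on \<open>u\<close> are
  \<open>2 * b2 - v\<close> and \<open>2 * (b1 - b3) + v\<close>. Their sum does not depend on
  \<open>v\<close> and is nonnegative exactly when \<open>b3 \<le> b1 + b2\<close>; otherwise the
  region is empty.\<close>

lemma area_quadrilateral:
  assumes c: "compact U" and U: "U = {(v::real, u::real). 0 \<le> v \<and> 0 \<le> u \<and> u / 2 - v / 2 \<le> b1 - b3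
      \<and> u / 2 + v / 2 \<le> b2 \<and> v \<le> 2 * b3}"
    and b: "0 \<le> b1" "0 \<le> b3"
  shows "measure lebesgue U = (if b3 \<le> b1 + b2 then
    2 * (max 0 b2 ^ 2 - max 0 (b2 - b3) ^ 2) - max 0 (b2 + b3 - b1) ^ 2 + max 0 (b2 - b1 - b3) ^ 2
        + 2 * max 0 (b3 - b1) ^ 2 else 0)"
proof (cases "b3 \<le> b1 + b2")
  case True
  have "measure lebesgue U =
    2 * (max 0 b2 ^ 2 - max 0 (b2 - b3) ^ 2) - max 0 (b2 + b3 - b1) ^ 2 + max 0 (b2 - b1 - b3) ^ 2
        + 2 * max 0 (b3 - b1) ^ 2"
  proof (rule measure_by_slices[OF c, of 0 "2 * b3"])
    fix t assume t: "0 \<le> t" "t \<le> 2 * b3"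
    then have "{v. (t, v) \<in> U} = {v. 0 \<le> v \<and> v \<le> min (2 * b2 - t) (2 * (b1 - b3) + t)}" by (auto
        simp: U)
    then have "measure lebesgue {v. (t, v) \<in> U} = max 0 (min (2 * b2 - t) (2 * (b1 - b3) + t))"
      by (simp only: length_interval diff_0_right)
    also have "\<dots> = max 0 (2 * b2 + (-1) * t) - max 0 (2 * (b2 - b1 + b3) + (-2) * t)
      + max 0 (2 * (b3 - b1) + (-1) * t)"
      by (subst max0_min_linear) (use True in \<open>auto simp: algebra_simps\<close>)
    finally show "measure lebesgue {v. (t, v) \<in> U} = max 0 (2 * b2 + (-1) * t) - max 0 (2 * (b2
        - b1 + b3) + (-2) * t)
      + max 0 (2 * (b3 - b1) + (-1) * t)" .
  next
    have b0: "0 \<le> 2 * b3" using b by simp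
    \<comment> \<open>At the right end the argument of this truncation is
      \<open>- 2 * b1\<close>.\<close>
    have z: "max 0 (2 * (b3 - b1) + (-1) * (2 * b3)) = 0" using b by simp
    have e: "2 * b2 + -1 * (2 * b3) = 2 * (b2 - b3)"
        "2 * (b2 - b1 + b3) + -2 * (2 * b3) = 2 * (b2 - b1 - b3)" by auto
    show "((\<lambda>t. max 0 (2 * b2 + (-1) * t) - max 0 (2 * (b2 - b1 + b3) + (-2) * t)
      + max 0 (2 * (b3 - b1) + (-1) * t)) has_integral
      2 * (max 0 b2 ^ 2 - max 0 (b2 - b3) ^ 2) - max 0 (b2 + b3 - b1) ^ 2 + max 0 (b2 - b1
          - b3) ^ 2 + 2 * max 0 (b3 - b1) ^ 2) {0..2 * b3}"
      by (rule has_integral_eq_rhs[OF has_integral_add[OF has_integral_diff[OF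
            has_integral_max0_linear[OF b0] has_integral_max0_linear[OF b0]]
                has_integral_max0_linear[OF b0]]],
          simp, simp, simp, unfold z, unfold e max0_double,
              simp add: power_mult_distrib field_simps)
  qed (auto simp: U)
  then show ?thesis using True by simp
next
  case False
  then have "U = {}" by (auto simp: U)
  then show ?thesis using False by (simp only: measure_empty) simp
qed

section \<open>Volumes of fibres\<close>

lemma volume_corner:
  assumes c: "compact U" and U: "U = {(u::real, v::real, w::real). 0 \<le> u \<and> 0 \<le> v \<and> 0 \<le> w
      \<and> u + v + w \<le> s}"
  shows "measure lebesgue U = max 0 s ^ 3 / 6"
proof (cases "0 \<le> s")
  case True
  show ?thesis
  proof (rule measure_by_slices[OF c, of 0 s])
    fix t assume "0 \<le> t" "t \<le> s"
    then have "{z. (t, z) \<in> U} = {(v, w). 0 \<le> v \<and> 0 \<le> w \<and> v + w \<le> s + (-1) * t}"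
      by (auto simp: U)
    with compact_slice_snd[OF c, of t]
    show "measure lebesgue {z. (t, z) \<in> U} = max 0 (s + (-1) * t) ^ 2 / 2"
      by (rule area_triangle_corner)
  next
    show "((\<lambda>t. max 0 (s + (-1) * t) ^ 2 / 2) has_integral max 0 s ^ 3 / 6) {0..s}"
      by (rule has_integral_eq_rhs[OF has_integral_divide[OF has_integral_max0_linear_square]])
        (use True in auto)
  qed (auto simp: U)
next
  case False
  then have "U = {}" by (auto simp: U)
  then show ?thesis using False by (simp only: measure_empty) simp
qed

lemma volume_edge_truncated:
  assumes c: "compact U"
    and U: "U = {(w::real, u::real, v::real). 0 \<le> w \<and> 0 \<le> u \<and> 0 \<le> v \<and> u + v + w / 2 \<le> a
        \<and> w / 2 \<le> b}"
    and b: "0 \<le> b"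
  shows "measure lebesgue U = (max 0 a ^ 3 - max 0 (a - b) ^ 3) / 3"
proof (rule measure_by_slices[OF c, of 0 "2 * b"])
  fix t assume "0 \<le> t" "t \<le> 2 * b"
  then have "{z. (t, z) \<in> U} = {(u, v). 0 \<le> u \<and> 0 \<le> v \<and> u + v \<le> a + (-1/2) * t}"
    by (auto simp: U)
  with compact_slice_snd[OF c, of t]
  show "measure lebesgue {z. (t, z) \<in> U} = max 0 (a + (-1/2) * t) ^ 2 / 2"
    by (rule area_triangle_corner)
next
  show "((\<lambda>t. max 0 (a + (-1/2) * t) ^ 2 / 2) has_integral (max 0 a ^ 3 - max 0 (a
      - b) ^ 3) / 3) {0..2 * b}"
    by (rule has_integral_eq_rhs[OF has_integral_divide[OF has_integral_max0_linear_square]])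
      (use b in \<open>auto simp: field_simps\<close>)
qed (auto simp: U)

text \<open>Inclusion-exclusion once more: the part beyond \<open>v / 2 = b2\<close> is a corner
  with \<open>b1 - b2\<close> in place of \<open>b1\<close>, and likewise for \<open>w\<close>.
  Halving two coordinates in the constraint multiplies the corner volume \<open>b1 ^ 3 / 6\<close>
  by \<open>4\<close>.\<close>

lemma volume_two_edges_truncated:
  assumes c: "compact U"
    and U: "U = {(v::real, w::real, u::real). 0 \<le> v \<and> 0 \<le> w \<and> 0 \<le> u \<and> u + v / 2 + w / 2 \<le> b1
        \<and> v / 2 \<le> b2 \<and> w / 2 \<le> b3}"
    and b: "0 \<le> b2" "0 \<le> b3"
  shows "measure lebesgue U =
    2 / 3 * (max 0 b1 ^ 3 - max 0 (b1 - b2) ^ 3 - max 0 (b1 - b3) ^ 3 + max 0 (b1 - b2 - b3) ^ 3)"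
proof (rule measure_by_slices[OF c, of 0 "2 * b2"])
  fix t assume "0 \<le> t" "t \<le> 2 * b2"
  then have "{z. (t, z) \<in> U} = {(w, u). 0 \<le> w \<and> 0 \<le> u \<and> u + w / 2 \<le> b1 + (-1/2) * t \<and> w / 2 \<le> b3}"
    by (auto simp: U)
  from area_trapezoid[OF compact_slice_snd[OF c, of t] this b(2)]
  show "measure lebesgue {z. (t, z) \<in> U} = max 0 (b1 + (-1/2) * t) ^ 2 - max 0 (b1 - b3
      + (-1/2) * t) ^ 2"
    by (simp add: algebra_simps)
next
  have b0: "0 \<le> 2 * b2" using b by simp
  have e: "b1 - b3 + - 1 / 2 * (2 * b2) = b1 - b2 - b3" by simp
  show "((\<lambda>t. max 0 (b1 + (-1/2) * t) ^ 2 - max 0 (b1 - b3 + (-1/2) * t) ^ 2) has_integral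
    2 / 3 * (max 0 b1 ^ 3 - max 0 (b1 - b2) ^ 3 - max 0 (b1 - b3) ^ 3 + max 0 (b1 - b2
        - b3) ^ 3)) {0..2 * b2}"
    by (rule has_integral_eq_rhs[OF has_integral_diff[OF
          has_integral_max0_linear_square[OF b0] has_integral_max0_linear_square[OF b0]]], simp,
              simp,
        unfold e, simp add: field_simps)
qed (auto simp: U)

text \<open>At fixed \<open>v\<close> the slice is a rectangle cut by
  \<open>u + w \<le> 2 * b1\<close>, as in \<open>area_pentagon\<close>. The order
  \<open>b2 \<le> b3\<close> keeps both sides of the rectangle nonnegative for all \<open>v\<close>
  up to \<open>2 * b2\<close>.\<close>

lemma volume_three_edges:
  assumes c: "compact U"
    and U: "U = {(v::real, u::real, w::real). 0 \<le> v \<and> 0 \<le> u \<and> 0 \<le> w \<and> u + w \<le> 2 * b1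
        \<and> u + v \<le> 2 * b2 \<and> v + w \<le> 2 * b3}"
    and b: "0 \<le> b1" "0 \<le> b2" "b2 \<le> b3"
  shows "measure lebesgue U = 4 * b1 ^ 2 * b2 - 4 / 3 * b1 ^ 3 + 4 / 3 * max 0 (b1 - b2) ^ 3
    - 2 / 3 * max 0 (b1 + b2 - b3) ^ 3 + 4 / 3 * max 0 (b1 - b3) ^ 3 - 2 / 3 * max 0 (b1 - b2
        - b3) ^ 3"
proof (rule measure_by_slices[OF c, of 0 "2 * b2"])
  fix t assume t: "0 \<le> t" "t \<le> 2 * b2"
  then have "{z. (t, z) \<in> U} =
    {(u, w). 0 \<le> u \<and> u \<le> 2 * b2 - t \<and> 0 \<le> w \<and> w \<le> 2 * b3 - t \<and> u + w \<le> 2 * b1}"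
    by (auto simp: U)
  from area_pentagon[OF compact_slice_snd[OF c, of t] this] t b
  have "measure lebesgue {z. (t, z) \<in> U} = (max 0 (2 * b1) ^ 2 - max 0 (2 * b1 - (2 * b2 - t)) ^ 2 -
      max 0 (2 * b1 - (2 * b3 - t)) ^ 2 + max 0 (2 * b1 - (2 * b2 - t) - (2 * b3 - t)) ^ 2) / 2"
          by simp
  also have "\<dots> = ((2 * b1) ^ 2 - max 0 (2 * (b1 - b2) + 1 * t) ^ 2 - max 0 (2 * (b1 - b3)
      + 1 * t) ^ 2 +
      max 0 (2 * (b1 - b2 - b3) + 2 * t) ^ 2) / 2"
    using b by (simp add: algebra_simps)
  finally show "measure lebesgue {z. (t, z) \<in> U} = ((2 * b1) ^ 2 - max 0 (2 * (b1 - b2)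
      + 1 * t) ^ 2 -
      max 0 (2 * (b1 - b3) + 1 * t) ^ 2 + max 0 (2 * (b1 - b2 - b3) + 2 * t) ^ 2) / 2" .
next
  have b0: "0 \<le> 2 * b2" using b by simp
  have e: "2 * (b1 - b2) + 1 * (2 * b2) = 2 * b1"
      "2 * (b1 - b3) + 1 * (2 * b2) = 2 * (b1 + b2 - b3)"
    "2 * (b1 - b2 - b3) + 2 * (2 * b2) = 2 * (b1 + b2 - b3)" by auto
  show "((\<lambda>t. ((2 * b1) ^ 2 - max 0 (2 * (b1 - b2) + 1 * t) ^ 2 -
      max 0 (2 * (b1 - b3) + 1 * t) ^ 2 + max 0 (2 * (b1 - b2 - b3) + 2 * t) ^ 2) / 2) has_integral
    4 * b1 ^ 2 * b2 - 4 / 3 * b1 ^ 3 + 4 / 3 * max 0 (b1 - b2) ^ 3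
    - 2 / 3 * max 0 (b1 + b2 - b3) ^ 3 + 4 / 3 * max 0 (b1 - b3) ^ 3 - 2 / 3 * max 0 (b1 - b2
        - b3) ^ 3) {0..2 * b2}"
    by (rule has_integral_eq_rhs[OF has_integral_divide[OF has_integral_add[OF has_integral_diff[OF
          has_integral_diff[OF has_integral_const_real has_integral_max0_linear_square[OF b0]]
          has_integral_max0_linear_square[OF b0]] has_integral_max0_linear_square[OF b0]]]], simp,
              simp, simp,
        unfold e max0_double, use b in \<open>simp add: power_mult_distrib field_simps power2_eq_square
            power3_eq_cube\<close>)
qed (use b in \<open>auto simp: U\<close>)

text \<open>The slices at fixed \<open>w\<close> are rectangles. By \<open>b1 \<le> b2\<close> the
  side belonging to \<open>b1\<close> vanishes first, so \<open>w\<close> runs up to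
  \<open>2 * b1\<close> and the volume is a single polynomial.\<close>

lemma volume_double_corner:
  assumes c: "compact U"
    and U: "U = {(w::real, u::real, v::real). 0 \<le> w \<and> 0 \<le> u \<and> 0 \<le> v \<and> u + w / 2 \<le> b1
        \<and> v + w / 2 \<le> b2}"
    and b: "0 \<le> b1" "b1 \<le> b2"
  shows "measure lebesgue U = b1 ^ 2 * b2 - b1 ^ 3 / 3"
proof (rule measure_by_slices[OF c, of 0 "2 * b1"])
  fix t assume t: "0 \<le> t" "t \<le> 2 * b1"
  then have "{z. (t, z) \<in> U} = {(u, v). 0 \<le> u \<and> u \<le> b1 - t / 2 \<and> 0 \<le> v \<and> v \<le> b2 - t / 2}"
    by (auto simp: U)
  from area_box[OF compact_slice_snd[OF c, of t] this] t b
  show "measure lebesgue {z. (t, z) \<in> U} = (b1 - t / 2) * (b2 - t / 2)" by simp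
next
  let ?F = "\<lambda>t. b1 * b2 * t - (b1 + b2) * t ^ 2 / 4 + t ^ 3 / 12"
  have "((\<lambda>t. (b1 - t / 2) * (b2 - t / 2)) has_integral ?F (2 * b1) - ?F 0) {0..2 * b1}"
  proof (rule fundamental_theorem_of_calculus)
    fix t
    show "(?F has_vector_derivative (b1 - t / 2) * (b2 - t / 2)) (at t within {0..2 * b1})"
      unfolding has_real_derivative_iff_has_vector_derivative[symmetric]
      by (auto intro!: derivative_eq_intros simp: field_simps power2_eq_square)
  qed (use b in simp)
  then show "((\<lambda>t. (b1 - t / 2) * (b2 - t / 2)) has_integral b1 ^ 2 * b2 - b1 ^ 3 / 3) {0..2 * b1}"
    by (rule has_integral_eq_rhs) (simp add: eval_nat_numeral field_simps)
qed (auto simp: U)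

section \<open>The splines in barycentric coordinates\<close>

lemma subtriangle_base:
  fixes a b c :: "real^2"
  assumes nc: "\<not> collinear {a, b, c}"
    and q: "q0 = r0 *\<^sub>R a + m0 *\<^sub>R b + t0 *\<^sub>R c" "q1 = r1 *\<^sub>R a + m1 *\<^sub>R b + t1 *\<^sub>R c"
      "q2 = r2 *\<^sub>R a + m2 *\<^sub>R b + t2 *\<^sub>R c"
    and t: "r0 + m0 + t0 = 1" "r1 + m1 + t1 = 1" "r2 + m2 + t2 = 1"
    and D: "\<bar>r0 * (m1 * t2 - m2 * t1) - m0 * (r1 * t2 - r2 * t1) + t0 * (r1 * m2 - r2 * m1)\<bar> = D"
        "D \<noteq> 0"
  shows "measure lebesgue (convex hull {q0, q1, q2}) = D * measure lebesgue (convex hull {a, b, c})"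
    and "\<not> collinear {q0, q1, q2}"
proof -
  show eq: "measure lebesgue (convex hull {q0, q1, q2}) = D * measure lebesgue (convex hull {a, b,
      c})"
    using measure_subtriangle[OF q t] D by simp
  show "\<not> collinear {q0, q1, q2}"
    using measure_triangle_collinear[of q0 q1 q2] measure_triangle_pos[OF nc] D(2) eq by auto
qed

lemma midpoint_eq: "midpoint a b = (1/2) *\<^sub>R a + (1/2) *\<^sub>R (b :: 'a::real_vector)"
  by (simp add: midpoint_def scaleR_add_right)

text \<open>\<open>P\<close>, \<open>Q\<close>, \<open>R\<close> stand for the vertices of the large
  triangle in any order, so each type of spline is computed once and carried to its symmetric copies
  by interpretation.\<close>

locale barycentric_triangle =
  fixes P Q R x :: "real^2" and b1 b2 b3 :: real
  assumes nc: "\<not> collinear {P, Q, R}"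
    and x: "x = b1 *\<^sub>R P + b2 *\<^sub>R Q + b3 *\<^sub>R R"
    and b_sum: "b1 + b2 + b3 = 1"
    and b_nonneg: "0 \<le> b1" "0 \<le> b2" "0 \<le> b3"
begin

definition "area = measure lebesgue (convex hull {P, Q, R})"

definition "centroid = (1/3) *\<^sub>R (P + Q + R)"

lemma area_pos: "area > 0"
  unfolding area_def by (rule measure_triangle_pos[OF nc])

lemma b1_eq: "b1 = 1 - b2 - b3"
  using b_sum by simp

section \<open>Base triangles and the coordinates of \<open>x\<close> in them\<close>

lemma base_corner:
  "measure lebesgue (convex hull {P, midpoint P Q, midpoint P R}) = area / 4"
  "\<not> collinear {P, midpoint P Q, midpoint P R}"
  \<comment> \<open>Each point is followed by its three barycentric coordinates; the final argument
    is the absolute value of their determinant.\<close>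
  using subtriangle_base[OF nc, of P 1 0 0 "midpoint P Q" "1/2" "1/2" 0 "midpoint P R" "1/2"
      0 "1/2" "1/4"]
  by (simp_all add: midpoint_eq area_def)

lemma base_half:
  "measure lebesgue (convex hull {P, Q, midpoint P R}) = area / 2"
  "\<not> collinear {P, Q, midpoint P R}"
  using subtriangle_base[OF nc, of P 1 0 0 Q 0 1 0 "midpoint P R" "1/2" 0 "1/2" "1/2"]
  by (simp_all add: midpoint_eq area_def)

lemma base_centroid:
  "measure lebesgue (convex hull {P, Q, centroid}) = area / 3"
  "\<not> collinear {P, Q, centroid}"
  using subtriangle_base[OF nc, of P 1 0 0 Q 0 1 0 centroid "1/3" "1/3" "1/3" "1/3"]
  by (simp_all add: centroid_def area_def scaleR_add_right)

lemma base_midpoints_centroid: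
  "measure lebesgue (convex hull {midpoint P Q, midpoint P R, centroid}) = area / 12"
  "\<not> collinear {midpoint P Q, midpoint P R, centroid}"
  using subtriangle_base[OF nc, of "midpoint P Q" "1/2" "1/2" 0 "midpoint P R" "1/2" 0 "1/2"
      centroid "1/3" "1/3" "1/3" "1/12"]
  by (simp_all add: centroid_def area_def scaleR_add_right midpoint_eq)

lemma base_midpoints:
  "measure lebesgue (convex hull {midpoint P Q, midpoint Q R, midpoint P R}) = area / 4"
  "\<not> collinear {midpoint P Q, midpoint Q R, midpoint P R}"
  using subtriangle_base[OF nc, of "midpoint P Q" "1/2" "1/2" 0 "midpoint Q R" 0 "1/2" "1/2"
      "midpoint P R" "1/2" 0 "1/2" "1/4"]
  by (simp_all add: area_def midpoint_eq)

text \<open>Coordinates relative to a base triangle may be negative, since \<open>x\<close> ranges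
  over the whole large triangle; this is one source of the truncations in the spline
  formulas.\<close>

lemma x_corner: "x = (2 * b1 - 1) *\<^sub>R P + (2 * b2) *\<^sub>R midpoint P Q + (2 * b3) *\<^sub>R midpoint P R"
  by (simp add: vec_eq_iff forall_2 x midpoint_eq b1_eq field_simps)

lemma x_half: "x = (b1 - b3) *\<^sub>R P + b2 *\<^sub>R Q + (2 * b3) *\<^sub>R midpoint P R"
  by (simp add: vec_eq_iff forall_2 x midpoint_eq field_simps)

lemma x_centroid: "x = (b1 - b3) *\<^sub>R P + (b2 - b3) *\<^sub>R Q + (3 * b3) *\<^sub>R centroid"
  by (simp add: vec_eq_iff forall_2 x centroid_def field_simps)

lemma x_midpoints_centroid: "x = (2 * (b1 - b3)) *\<^sub>R midpoint P Q + (2 * (b1 - b2)) *\<^sub>R midpoint P R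
    + (3 - 6 * b1) *\<^sub>R centroid"
  by (simp add: vec_eq_iff forall_2 x centroid_def midpoint_eq b1_eq field_simps)

lemma x_midpoints: "x = (1 - 2 * b3) *\<^sub>R midpoint P Q + (1 - 2 * b1) *\<^sub>R midpoint Q R + (1
    - 2 * b2) *\<^sub>R midpoint P R"
  by (simp add: vec_eq_iff forall_2 x midpoint_eq b1_eq field_simps)

section \<open>Linear splines\<close>

lemma spline1_corner:
  "simplex_spline TYPE(real) area {#P, midpoint P Q, midpoint P R, P#} x = 4 * max 0 (2 * b1 - 1)"
proof -
  have "{u. 0 \<le> u \<and> u * 1 \<le> 2 * b1 - 1 \<and> u * 0 \<le> 2 * b2 \<and> u * 0 \<le> 2 * b3} =
      {u. 0 \<le> u \<and> u \<le> 2 * b1 - 1}"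
    using b_nonneg by auto
  then show ?thesis
    using simplex_spline_real[OF base_corner(2) x_corner, of P 1 0 0 area] b_sum area_pos
    by (simp add: base_corner length_interval)
qed

text \<open>The factor \<open>6\<close> is the area ratio \<open>3\<close> of the large triangle to
  the base triangle, times \<open>2\<close> because the coordinates \<open>1/2\<close> of the
  midpoint double the length of the fibre. The factors in the other formulas arise in the same
  way.\<close>

lemma spline1_edge:
  "simplex_spline TYPE(real) area {#P, Q, centroid, midpoint P Q#} x = 6 * max 0 (min b1 b2 - b3)"
proof -
  have "{u. 0 \<le> u \<and> u * (1/2) \<le> b1 - b3 \<and> u * (1/2) \<le> b2 - b3 \<and> u * 0 \<le> 3 * b3} =
      {u. 0 \<le> u \<and> u \<le> 2 * (min b1 b2 - b3)}" (is "?U = _")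
    using b_nonneg by auto
  then have "measure lebesgue ?U = 2 * max 0 (min b1 b2 - b3)"
    by (simp only: length_interval diff_0_right max0_double)
  then show ?thesis
    using simplex_spline_real[OF base_centroid(2) x_centroid, of "midpoint P Q" "1/2" "1/2"
        0 area] b_sum area_pos
    by (simp add: base_centroid midpoint_eq)
qed

lemma spline1_inner:
  "simplex_spline TYPE(real) area {#midpoint P Q, midpoint P R, centroid, P#} x =
    12 * max 0 (b1 - max b2 b3 - max 0 (2 * b1 - 1))"
proof -
  \<comment> \<open>The knot \<open>P\<close> lies outside the base triangle, with coordinate
    \<open>-3\<close> at the centroid. That constraint therefore bounds \<open>u\<close> from below,
    by \<open>2 * b1 - 1\<close>.\<close>
  have "{u. 0 \<le> u \<and> u * 2 \<le> 2 * (b1 - b3) \<and> u * 2 \<le> 2 * (b1 - b2) \<and> u * (-3) \<le> 3 - 6 * b1} =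
      {u. max 0 (2 * b1 - 1) \<le> u \<and> u \<le> b1 - max b2 b3}" (is "?U = _")
    by auto
  then have "measure lebesgue ?U = max 0 (b1 - max b2 b3 - max 0 (2 * b1 - 1))"
    by (simp only: length_interval)
  moreover have "P = 2 *\<^sub>R midpoint P Q + 2 *\<^sub>R midpoint P R + (-3) *\<^sub>R centroid"
    by (simp add: vec_eq_iff forall_2 centroid_def midpoint_eq field_simps)
  ultimately show ?thesis
    using simplex_spline_real[OF base_midpoints_centroid(2) x_midpoints_centroid, of P 2 2 "-3"
        area] b_sum area_pos
    by (simp add: base_midpoints_centroid)
qed

lemma spline1_centre:
  "simplex_spline TYPE(real) area {#midpoint P Q, midpoint Q R, midpoint P R, centroid#} x =
    12 * max 0 (1 - 2 * max b1 (max b2 b3))"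
proof -
  have "{u. 0 \<le> u \<and> u * (1/3) \<le> 1 - 2 * b3 \<and> u * (1/3) \<le> 1 - 2 * b1 \<and> u * (1/3) \<le> 1 - 2 * b2} =
      {u. 0 \<le> u \<and> u \<le> 3 * (1 - 2 * max b1 (max b2 b3))}" (is "?U = _")
    by auto
  moreover have "max 0 (3 * z) = 3 * max 0 z" for z :: real by (simp add: max_def)
  ultimately have "measure lebesgue ?U = 3 * max 0 (1 - 2 * max b1 (max b2 b3))"
    by (simp only: length_interval diff_0_right)
  moreover have "centroid = (1/3) *\<^sub>R midpoint P Q + (1/3) *\<^sub>R midpoint Q R + (1/3) *\<^sub>R midpoint P R"
    by (simp add: vec_eq_iff forall_2 centroid_def midpoint_eq field_simps)
  ultimately show ?thesis
    using simplex_spline_real[OF base_midpoints(2) x_midpoints, of centroid "1/3" "1/3" "1/3"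
        area] b_sum area_pos
    by (simp add: base_midpoints)
qed

section \<open>Quadratic splines\<close>

lemma spline2_corner:
  "simplex_spline TYPE(real^2) area {#P, midpoint P Q, midpoint P R, P,
      P#} x = 4 * max 0 (2 * b1 - 1) ^ 2"
proof -
  have P: "P = 1 *\<^sub>R P + 0 *\<^sub>R midpoint P Q + 0 *\<^sub>R midpoint P R" by simp
  note spl = simplex_spline_vec2[OF base_corner(2) x_corner _ P _ P]
  from spl(1) have "measure lebesgue {(u, v). 0 \<le> u \<and> 0 \<le> v \<and> u * 1 + v * 1 \<le> 2 * b1 - 1 \<and>
      u * 0 + v * 0 \<le> 2 * b2 \<and> u * 0 + v * 0 \<le> 2 * b3} = max 0 (2 * b1 - 1) ^ 2 / 2"
    by (rule area_triangle_corner) (use b_nonneg b_sum in auto)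
  then show ?thesis
    using spl(2)[of area] b_sum area_pos by (simp add: base_corner)
qed

text \<open>In this base both \<open>P\<close> and \<open>midpoint P Q\<close> have coordinate
  \<open>0\<close> at \<open>midpoint P R\<close>; the remaining two constraints have the shape of
  \<open>area_trapezoid\<close>, whose coordinates follow the order of the last two knots.\<close>

lemma spline2_edge:
  "simplex_spline TYPE(real^2) area {#P, Q, midpoint P R, midpoint P Q, P#} x =
    4 * (max 0 (b1 - b3) ^ 2 - max 0 (b1 - b3 - b2) ^ 2)"
proof -
  have P: "P = 1 *\<^sub>R P + 0 *\<^sub>R Q + 0 *\<^sub>R midpoint P R"
    and PQ: "midpoint P Q = (1/2) *\<^sub>R P + (1/2) *\<^sub>R Q + 0 *\<^sub>R midpoint P R"
        by (simp_all add: midpoint_eq)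
  note spl = simplex_spline_vec2[OF base_half(2) x_half _ PQ _ P]
  from spl(1) have "measure lebesgue {(w, u). 0 \<le> w \<and> 0 \<le> u \<and> w * (1/2) + u * 1 \<le> b1 - b3 \<and>
      w * (1/2) + u * 0 \<le> b2 \<and> w * 0 + u * 0 \<le> 2 * b3} = max 0 (b1 - b3) ^ 2 - max 0 (b1 - b3
          - b2) ^ 2"
    by (rule area_trapezoid) (use b_nonneg b_sum in auto)
  then show ?thesis
    using spl(2)[of area] b_sum area_pos by (simp add: base_half)
qed

text \<open>Since the coordinates sum to \<open>1\<close>, the condition
  \<open>b3 \<le> b1 + b2\<close> means \<open>b3 \<le> 1/2\<close>: no knot lies beyond the line
  through \<open>midpoint P R\<close> and \<open>midpoint Q R\<close> on the side of
  \<open>R\<close>.\<close>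

lemma spline2_inner:
  "simplex_spline TYPE(real^2) area {#P, Q, midpoint P R, midpoint Q R, midpoint P Q#} x =
    (if b3 \<le> b1 + b2 then 8 * (b2 ^ 2 - max 0 (b2 - b3) ^ 2) - 4 * max 0 (b2 + b3 - b1) ^ 2
      + 4 * max 0 (b2 - b1 - b3) ^ 2 + 8 * max 0 (b3 - b1) ^ 2 else 0)"
proof -
  have QR: "midpoint Q R = (-1/2) *\<^sub>R P + (1/2) *\<^sub>R Q + 1 *\<^sub>R midpoint P R"
    and PQ: "midpoint P Q = (1/2) *\<^sub>R P + (1/2) *\<^sub>R Q + 0 *\<^sub>R midpoint P R"
    by (simp_all add: vec_eq_iff forall_2 midpoint_eq)
  note spl = simplex_spline_vec2[OF base_half(2) x_half _ QR _ PQ]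
  from spl(1) have "measure lebesgue {(v, u). 0 \<le> v \<and> 0 \<le> u \<and> v * (-1/2) + u * (1/2) \<le> b1 - b3 \<and>
      v * (1/2) + u * (1/2) \<le> b2 \<and> v * 1 + u * 0 \<le> 2 * b3} = (if b3 \<le> b1 + b2 then
    2 * (max 0 b2 ^ 2 - max 0 (b2 - b3) ^ 2) - max 0 (b2 + b3 - b1) ^ 2 + max 0 (b2 - b1 - b3) ^ 2
        + 2 * max 0 (b3 - b1) ^ 2 else 0)"
    by (rule area_quadrilateral) (use b_nonneg b_sum in auto)
  then show ?thesis
    using spl(2)[of area] b_sum area_pos b_nonneg by (simp add: base_half)
qed

section \<open>Cubic splines\<close>

lemma spline3_corner:
  "simplex_spline TYPE(real^3) area {#P, midpoint P Q, midpoint P R, P, P,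
      P#} x = 4 * max 0 (2 * b1 - 1) ^ 3"
proof -
  have P: "P = 1 *\<^sub>R P + 0 *\<^sub>R midpoint P Q + 0 *\<^sub>R midpoint P R" by simp
  note spl = simplex_spline_vec3[OF base_corner(2) x_corner _ P _ P _ P]
  from spl(1) have "measure lebesgue {(u, v, w). 0 \<le> u \<and> 0 \<le> v \<and> 0 \<le> w \<and>
      u * 1 + v * 1 + w * 1 \<le> 2 * b1 - 1 \<and> u * 0 + v * 0 + w * 0 \<le> 2 * b2 \<and>
      u * 0 + v * 0 + w * 0 \<le> 2 * b3} = max 0 (2 * b1 - 1) ^ 3 / 6"
    by (rule volume_corner) (use b_nonneg b_sum in auto)
  then show ?thesis
    using spl(2)[of area] b_sum area_pos by (simp add: base_corner)
qed

lemma spline3_edge: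
  "simplex_spline TYPE(real^3) area {#P, Q, midpoint P R, midpoint P Q, P, P#} x =
    4 * (max 0 (b1 - b3) ^ 3 - max 0 (b1 - b3 - b2) ^ 3)"
proof -
  have P: "P = 1 *\<^sub>R P + 0 *\<^sub>R Q + 0 *\<^sub>R midpoint P R"
    and PQ: "midpoint P Q = (1/2) *\<^sub>R P + (1/2) *\<^sub>R Q + 0 *\<^sub>R midpoint P R"
        by (simp_all add: midpoint_eq)
  note spl = simplex_spline_vec3[OF base_half(2) x_half _ PQ _ P _ P]
  from spl(1) have "measure lebesgue {(w, u, v). 0 \<le> w \<and> 0 \<le> u \<and> 0 \<le> v \<and>
      w * (1/2) + u * 1 + v * 1 \<le> b1 - b3 \<and> w * (1/2) + u * 0 + v * 0 \<le> b2 \<and>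
      w * 0 + u * 0 + v * 0 \<le> 2 * b3} = (max 0 (b1 - b3) ^ 3 - max 0 (b1 - b3 - b2) ^ 3) / 3"
    by (rule volume_edge_truncated) (use b_nonneg b_sum in auto)
  then show ?thesis
    using spl(2)[of area] b_sum area_pos by (simp add: base_half)
qed

text \<open>All three vertices are knots of the remaining cubic splines, so the large triangle
  itself serves as base and \<open>x\<close> keeps its coordinates.\<close>

lemma vertices_trivial: "P = 1 *\<^sub>R P + 0 *\<^sub>R Q + 0 *\<^sub>R R" "Q = 0 *\<^sub>R P + 1 *\<^sub>R Q + 0 *\<^sub>R R"
  "midpoint P Q = (1/2) *\<^sub>R P + (1/2) *\<^sub>R Q + 0 *\<^sub>R R"
      "midpoint P R = (1/2) *\<^sub>R P + 0 *\<^sub>R Q + (1/2) *\<^sub>R R"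
  "midpoint Q R = 0 *\<^sub>R P + (1/2) *\<^sub>R Q + (1/2) *\<^sub>R R"
  by (simp_all add: midpoint_eq)

text \<open>The opposite order of \<open>b1\<close> and \<open>b2\<close> is obtained by exchanging
  \<open>P\<close> and \<open>Q\<close>, which leaves the knots unchanged.\<close>

lemma spline3_double:
  assumes "b1 \<le> b2"
  shows "simplex_spline TYPE(real^3) area {#P, Q, R, midpoint P Q, P,
      Q#} x = 6 * b1 ^ 2 * b2 - 2 * b1 ^ 3"
proof -
  note spl = simplex_spline_vec3[OF nc x b_sum vertices_trivial(3) _ vertices_trivial(1) _
      vertices_trivial(2)]
  from spl(1) have "measure lebesgue {(w, u, v). 0 \<le> w \<and> 0 \<le> u \<and> 0 \<le> v \<and>
      w * (1/2) + u * 1 + v * 0 \<le> b1 \<and> w * (1/2) + u * 0 + v * 1 \<le> b2 \<and>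
      w * 0 + u * 0 + v * 0 \<le> b3} = b1 ^ 2 * b2 - b1 ^ 3 / 3"
    by (rule volume_double_corner) (use b_nonneg b_sum assms in auto)
  then show ?thesis
    using spl(2)[of area] b_sum area_pos by (simp add: area_def)
qed

lemma spline3_inner:
  "simplex_spline TYPE(real^3) area {#P, Q, R, midpoint P Q, midpoint P R, P#} x =
    4 * (b1 ^ 3 - max 0 (b1 - b2) ^ 3 - max 0 (b1 - b3) ^ 3 + max 0 (b1 - b2 - b3) ^ 3)"
proof -
  note spl = simplex_spline_vec3[OF nc x b_sum vertices_trivial(3) _ vertices_trivial(4) _
      vertices_trivial(1)]
  from spl(1) have "measure lebesgue {(v, w, u). 0 \<le> v \<and> 0 \<le> w \<and> 0 \<le> u \<and>
      v * (1/2) + w * (1/2) + u * 1 \<le> b1 \<and> v * (1/2) + w * 0 + u * 0 \<le> b2 \<and>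
      v * 0 + w * (1/2) + u * 0 \<le> b3} =
      2 / 3 * (max 0 b1 ^ 3 - max 0 (b1 - b2) ^ 3 - max 0 (b1 - b3) ^ 3 + max 0 (b1 - b2 - b3) ^ 3)"
    by (rule volume_two_edges_truncated) (use b_nonneg b_sum in auto)
  then show ?thesis
    using spl(2)[of area] b_sum area_pos b_nonneg by (simp add: area_def)
qed

text \<open>With \<open>midpoint Q R\<close> as outer coordinate the fibre is the region of
  \<open>volume_three_edges\<close>, from which the order of \<open>b2\<close> and \<open>b3\<close>
  is inherited; exchanging \<open>Q\<close> and \<open>R\<close> covers the other order.\<close>

lemma spline3_centre:
  assumes "b2 \<le> b3"
  shows "simplex_spline TYPE(real^3) area {#P, Q, R, midpoint Q R, midpoint P Q, midpoint P R#} x =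
    24 * b1 ^ 2 * b2 - 8 * b1 ^ 3 + 8 * max 0 (b1 - b2) ^ 3
    - 4 * max 0 (b1 + b2 - b3) ^ 3 + 8 * max 0 (b1 - b3) ^ 3 - 4 * max 0 (b1 - b2 - b3) ^ 3"
proof -
  note spl = simplex_spline_vec3[OF nc x b_sum vertices_trivial(5) _ vertices_trivial(3) _
      vertices_trivial(4)]
  from spl(1) have "measure lebesgue {(v, u, w). 0 \<le> v \<and> 0 \<le> u \<and> 0 \<le> w \<and>
      v * 0 + u * (1/2) + w * (1/2) \<le> b1 \<and> v * (1/2) + u * (1/2) + w * 0 \<le> b2 \<and>
      v * (1/2) + u * 0 + w * (1/2) \<le> b3} =
      4 * b1 ^ 2 * b2 - 4 / 3 * b1 ^ 3 + 4 / 3 * max 0 (b1 - b2) ^ 3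
    - 2 / 3 * max 0 (b1 + b2 - b3) ^ 3 + 4 / 3 * max 0 (b1 - b3) ^ 3 - 2 / 3 * max 0 (b1 - b2
        - b3) ^ 3"
    by (rule volume_three_edges) (use b_nonneg b_sum assms in auto)
  then show ?thesis
    using spl(2)[of area] b_sum area_pos by (simp add: area_def)
qed

end

section \<open>The identity in barycentric coordinates\<close>

text \<open>This and the functions up to \<open>cubic_centre\<close> are the spline values up to
  constant factors, with arguments in the order of \<open>P\<close>, \<open>Q\<close>,
  \<open>R\<close> in the locale.\<close>

definition hat_edge :: "real \<Rightarrow> real \<Rightarrow> real \<Rightarrow> real" where
  "hat_edge b1 b2 b3 = max 0 (min b1 b2 - b3)"

definition hat_inner :: "real \<Rightarrow> real \<Rightarrow> real \<Rightarrow> real" where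
  "hat_inner b1 b2 b3 = max 0 (b1 - max b2 b3 - max 0 (2 * b1 - 1))"

definition hat_centre :: "real \<Rightarrow> real \<Rightarrow> real \<Rightarrow> real" where
  "hat_centre b1 b2 b3 = max 0 (1 - 2 * max b1 (max b2 b3))"

definition quadratic_edge :: "real \<Rightarrow> real \<Rightarrow> real \<Rightarrow> real" where
  "quadratic_edge b1 b2 b3 = max 0 (b1 - b3) ^ 2 - max 0 (b1 - b3 - b2) ^ 2"

text \<open>The next function and \<open>cubic_centre\<close> below are the values obtained by slicing, rewritten so that their
  symmetry is visible; that is what reduces the identity to ordered barycentric coordinates.\<close>

definition quadratic_inner :: "real \<Rightarrow> real \<Rightarrow> real \<Rightarrow> real" where
  "quadratic_inner b1 b2 b3 = (if b3 \<le> b1 + b2 then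
    3 * (b1 ^ 2 + b2 ^ 2 + b3 ^ 2) - 2 * (b1 * b2 + b2 * b3 + b3 * b1) - 2 * (max 0 (b1 - b3) ^ 2
        + max 0 (b2 - b3) ^ 2)
      - (max 0 (b2 + b3 - b1) ^ 2 + max 0 (b1 + b3 - b2) ^ 2) else 0)"

definition cubic_edge :: "real \<Rightarrow> real \<Rightarrow> real \<Rightarrow> real" where
  "cubic_edge b1 b2 b3 = max 0 (b1 - b3) ^ 3 - max 0 (b1 - b3 - b2) ^ 3"

text \<open>Both branches equal \<open>2 * b1 ^ 3\<close> when \<open>b1 = b2\<close>, which makes
  the function symmetric.\<close>

definition cubic_double :: "real \<Rightarrow> real \<Rightarrow> real" where
  "cubic_double b1 b2 = (if b1 \<le> b2 then 3 * b1 ^ 2 * b2 - b1 ^ 3 else 3 * b2 ^ 2 * b1 - b2 ^ 3)"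

definition cubic_inner :: "real \<Rightarrow> real \<Rightarrow> real \<Rightarrow> real" where
  "cubic_inner b1 b2 b3 = b1 ^ 3 - (max 0 (b1 - b2) ^ 3 + max 0 (b1 - b3) ^ 3) + max 0 (b1 - (b2
      + b3)) ^ 3"

definition cubic_centre :: "real \<Rightarrow> real \<Rightarrow> real \<Rightarrow> real" where
  "cubic_centre b1 b2 b3 = 3 * (b1 ^ 2 * (b2 + b3) + b2 ^ 2 * (b1 + b3) + b3 ^ 2 * (b1 + b2))
      - 12 * (b1 * b2 * b3)
    + (\<bar>b1 - b2\<bar> ^ 3 + \<bar>b2 - b3\<bar> ^ 3 + \<bar>b3 - b1\<bar> ^ 3)
    - (max 0 (b1 + b2 - b3) ^ 3 + max 0 (b2 + b3 - b1) ^ 3 + max 0 (b1 + b3 - b2) ^ 3)"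

lemma hat_edge_commute: "hat_edge b2 b1 b3 = hat_edge b1 b2 b3"
  by (simp add: hat_edge_def min.commute)

lemma hat_inner_commute: "hat_inner b1 b3 b2 = hat_inner b1 b2 b3"
  by (simp add: hat_inner_def max.commute)

lemma hat_centre_commute: "hat_centre b2 b1 b3 = hat_centre b1 b2 b3"
    "hat_centre b1 b3 b2 = hat_centre b1 b2 b3"
  by (simp_all add: hat_centre_def max.commute max.left_commute)

lemma quadratic_inner_commute: "quadratic_inner b2 b1 b3 = quadratic_inner b1 b2 b3"
  by (simp add: quadratic_inner_def ac_simps)

lemma cubic_double_ge: "b2 \<le> b1 \<Longrightarrow> cubic_double b1 b2 = 3 * b2 ^ 2 * b1 - b2 ^ 3"
  by (cases "b1 = b2") (auto simp: cubic_double_def)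

lemma cubic_double_commute: "cubic_double b2 b1 = cubic_double b1 b2"
  by (simp add: cubic_double_def)

lemma cubic_inner_commute: "cubic_inner b1 b3 b2 = cubic_inner b1 b2 b3"
  by (simp add: cubic_inner_def ac_simps)

lemma cubic_centre_commute: "cubic_centre b2 b1 b3 = cubic_centre b1 b2 b3"
    "cubic_centre b1 b3 b2 = cubic_centre b1 b2 b3"
  by (simp_all add: cubic_centre_def ac_simps abs_minus_commute)

text \<open>The sum over the basis for \<open>d = 1\<close>, in the order of the basis. The values
  of the affine function \<open>1 - p \<bullet> y\<close> at midpoints and centroid are written as
  averages of its values \<open>c1\<close>, \<open>c2\<close>, \<open>c3\<close> at the vertices, so
  that permuting the vertices visibly permutes the terms.\<close>

definition linear_sum :: "real \<Rightarrow> real \<Rightarrow> real \<Rightarrow> real \<Rightarrow> real \<Rightarrow> real \<Rightarrow> real" where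
  "linear_sum b1 b2 b3 c1 c2 c3 =
    max 0 (2 * b1 - 1) * c1 + max 0 (2 * b2 - 1) * c2 + max 0 (2 * b3 - 1) * c3
    + 2 * hat_edge b1 b2 b3 * ((c1 + c2) / 2) + 2 * hat_edge b2 b3 b1 * ((c2 + c3) / 2)
    + 2 * hat_edge b1 b3 b2 * ((c1 + c3) / 2)
    + 4 * hat_inner b1 b2 b3 * (((c1 + c2) / 2 + (c1 + c3) / 2) / 2)
    + 4 * hat_inner b2 b1 b3 * (((c1 + c2) / 2 + (c2 + c3) / 2) / 2)
    + 4 * hat_inner b3 b1 b2 * (((c1 + c3) / 2 + (c2 + c3) / 2) / 2)
    + 3 * hat_centre b1 b2 b3 * ((c1 + c2 + c3) / 3)"

definition quadratic_sum :: "real \<Rightarrow> real \<Rightarrow> real \<Rightarrow> real \<Rightarrow> real \<Rightarrow> real \<Rightarrow> real" where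
  "quadratic_sum b1 b2 b3 c1 c2 c3 =
    max 0 (2 * b1 - 1) ^ 2 * c1 ^ 2 + max 0 (2 * b2 - 1) ^ 2 * c2 ^ 2 + max 0 (2 * b3
        - 1) ^ 2 * c3 ^ 2
    + 2 * quadratic_edge b1 b2 b3 * (c1 * ((c1 + c2) / 2))
        + 2 * quadratic_edge b2 b1 b3 * (c2 * ((c1 + c2) / 2))
    + 2 * quadratic_edge b2 b3 b1 * (c2 * ((c2 + c3) / 2))
        + 2 * quadratic_edge b3 b2 b1 * (c3 * ((c2 + c3) / 2))
    + 2 * quadratic_edge b3 b1 b2 * (c3 * ((c1 + c3) / 2))
        + 2 * quadratic_edge b1 b3 b2 * (c1 * ((c1 + c3) / 2))
    + 3 * quadratic_inner b1 b2 b3 * ((c1 + c2) / 2 * ((c1 + c2 + c3) / 3))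
    + 3 * quadratic_inner b2 b3 b1 * ((c2 + c3) / 2 * ((c1 + c2 + c3) / 3))
    + 3 * quadratic_inner b1 b3 b2 * ((c1 + c3) / 2 * ((c1 + c2 + c3) / 3))"

definition cubic_sum :: "real \<Rightarrow> real \<Rightarrow> real \<Rightarrow> real \<Rightarrow> real \<Rightarrow> real \<Rightarrow> real" where
  "cubic_sum b1 b2 b3 c1 c2 c3 =
    max 0 (2 * b1 - 1) ^ 3 * c1 ^ 3 + max 0 (2 * b2 - 1) ^ 3 * c2 ^ 3 + max 0 (2 * b3
        - 1) ^ 3 * c3 ^ 3
    + 2 * cubic_edge b1 b2 b3 * (c1 ^ 2 * ((c1 + c2) / 2))
        + 2 * cubic_edge b2 b1 b3 * (c2 ^ 2 * ((c1 + c2) / 2))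
    + 2 * cubic_edge b2 b3 b1 * (c2 ^ 2 * ((c2 + c3) / 2))
        + 2 * cubic_edge b3 b2 b1 * (c3 ^ 2 * ((c2 + c3) / 2))
    + 2 * cubic_edge b3 b1 b2 * (c3 ^ 2 * ((c1 + c3) / 2))
        + 2 * cubic_edge b1 b3 b2 * (c1 ^ 2 * ((c1 + c3) / 2))
    + 2 * cubic_double b1 b2 * (c1 * c2 * ((c1 + c2) / 2))
        + 2 * cubic_double b2 b3 * (c2 * c3 * ((c2 + c3) / 2))
    + 2 * cubic_double b1 b3 * (c1 * c3 * ((c1 + c3) / 2))
    + 4 * cubic_inner b1 b2 b3 * (c1 * ((c1 + c2) / 2) * ((c1 + c3) / 2))
    + 4 * cubic_inner b2 b1 b3 * (c2 * ((c1 + c2) / 2) * ((c2 + c3) / 2))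
    + 4 * cubic_inner b3 b1 b2 * (c3 * ((c1 + c3) / 2) * ((c2 + c3) / 2))
    + cubic_centre b1 b2 b3 * (c1 * c2 * c3)"

text \<open>These two transpositions generate all permutations of the vertices, so the two equations
  suffice for sorting.\<close>

lemma linear_sum_commute:
  "linear_sum b2 b1 b3 c2 c1 c3 = linear_sum b1 b2 b3 c1 c2 c3"
  "linear_sum b1 b3 b2 c1 c3 c2 = linear_sum b1 b2 b3 c1 c2 c3"
  by (simp_all add: linear_sum_def hat_edge_commute hat_inner_commute hat_centre_commute ac_simps)

lemma quadratic_sum_commute:
  "quadratic_sum b2 b1 b3 c2 c1 c3 = quadratic_sum b1 b2 b3 c1 c2 c3"
  "quadratic_sum b1 b3 b2 c1 c3 c2 = quadratic_sum b1 b2 b3 c1 c2 c3"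
  by (simp_all add: quadratic_sum_def quadratic_inner_commute ac_simps)

lemma cubic_sum_commute:
  "cubic_sum b2 b1 b3 c2 c1 c3 = cubic_sum b1 b2 b3 c1 c2 c3"
  "cubic_sum b1 b3 b2 c1 c3 c2 = cubic_sum b1 b2 b3 c1 c2 c3"
  by (simp_all add: cubic_sum_def cubic_double_commute cubic_inner_commute cubic_centre_commute
      ac_simps)

text \<open>Sorted coordinates decide every comparison and every truncation except those governed by
  the sign of \<open>2 * b1 - 1\<close>. With \<open>b1\<close> eliminated, each of the two cases is
  a polynomial identity.\<close>

lemma
  fixes b1 b2 b3 c1 c2 c3 :: real
  assumes s: "b1 + b2 + b3 = 1" and o: "b1 \<ge> b2" "b2 \<ge> b3" "0 \<le> b3"
  shows linear_sum_sorted: "linear_sum b1 b2 b3 c1 c2 c3 = b1 * c1 + b2 * c2 + b3 * c3"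
    and quadratic_sum_sorted: "quadratic_sum b1 b2 b3 c1 c2 c3 = (b1 * c1 + b2 * c2 + b3 * c3) ^ 2"
    and cubic_sum_sorted: "cubic_sum b1 b2 b3 c1 c2 c3 = (b1 * c1 + b2 * c2 + b3 * c3) ^ 3"
proof -
  have b1: "b1 = 1 - b2 - b3" using s by simp
  have mm: "min b1 b2 = b2" "min b2 b3 = b3" "min b1 b3 = b3" "max b2 b3 = b2" "max b1 b3 = b1"
      "max b1 b2 = b1"
    using o by auto
  have corner: "max 0 (2 * b2 - 1) = 0" "max 0 (2 * b3 - 1) = 0"
    using o s by auto
  have diff: "max 0 (b1 - b2) = b1 - b2" "max 0 (b1 - b3) = b1 - b3" "max 0 (b2 - b3) = b2 - b3"
    "max 0 (b2 - b1) = 0" "max 0 (b3 - b1) = 0" "max 0 (b3 - b2) = 0"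
    using o by auto
  have abs: "\<bar>b1 - b2\<bar> = b1 - b2" "\<bar>b2 - b3\<bar> = b2 - b3" "\<bar>b3 - b1\<bar> = b1 - b3"
    using o by auto
  \<comment> \<open>As the coordinates sum to \<open>1\<close>, \<open>b1 - b2 - b3\<close> is
    \<open>2 * b1 - 1\<close>. Variants differing only in the order of terms are listed because the
    later unfolding is syntactic.\<close>
  have sum: "max 0 (b2 - b3 - b1) = 0" "max 0 (b2 - b1 - b3) = 0" "max 0 (b3 - b1 - b2) = 0"
      "max 0 (b3 - b2 - b1) = 0"
    "max 0 (b2 - (b1 + b3)) = 0" "max 0 (b3 - (b1 + b2)) = 0"
    "max 0 (b1 + b2 - b3) = b1 + b2 - b3" "max 0 (b2 + b1 - b3) = b1 + b2 - b3"
    "max 0 (b1 + b3 - b2) = b1 + b3 - b2" "max 0 (b3 + b1 - b2) = b1 + b3 - b2"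
    "max 0 (1 - 2 * b1) = max 0 (b2 + b3 - b1)"
    "max 0 (b1 - b2 - b3) = max 0 (2 * b1 - 1)" "max 0 (b1 - b3 - b2) = max 0 (2 * b1 - 1)"
    "max 0 (b1 - (b2 + b3)) = max 0 (2 * b1 - 1)" "max 0 (b3 + b2 - b1) = max 0 (b2 + b3 - b1)"
    using o s by (auto simp: algebra_simps)
  have dbl: "cubic_double b1 b2 = 3 * b2 ^ 2 * b1 - b2 ^ 3"
      "cubic_double b2 b3 = 3 * b3 ^ 2 * b2 - b3 ^ 3"
    "cubic_double b1 b3 = 3 * b3 ^ 2 * b1 - b3 ^ 3"
    using o by (simp_all add: cubic_double_ge)
  have le: "(b3 \<le> b1 + b2) = True" "(b2 \<le> b1 + b3) = True"
    using o by auto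
  have "linear_sum b1 b2 b3 c1 c2 c3 = b1 * c1 + b2 * c2 + b3 * c3 \<and>
    quadratic_sum b1 b2 b3 c1 c2 c3 = (b1 * c1 + b2 * c2 + b3 * c3) ^ 2 \<and>
    cubic_sum b1 b2 b3 c1 c2 c3 = (b1 * c1 + b2 * c2 + b3 * c3) ^ 3"
  proof (cases "2 * b1 \<le> 1")
    case True
    then have m: "max 0 (2 * b1 - 1) = 0" "max 0 (b2 + b3 - b1) = b2 + b3 - b1"
      and l: "(b1 \<le> b2 + b3) = True" using s by auto
    \<comment> \<open>The trailing \<open>- 0\<close> is left by the inner truncation in
      \<open>hat_inner\<close>, which is rewritten first.\<close>
    have "max 0 (b1 - b2 - 0) = b1 - b2" "max 0 (b2 - b1 - 0) = 0" "max 0 (b3 - b1 - 0) = 0"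
      using o by auto
    note E = mm corner diff abs sum m this le l if_True
    have "linear_sum b1 b2 b3 c1 c2 c3 = b1 * c1 + b2 * c2 + b3 * c3"
      unfolding linear_sum_def hat_edge_def hat_inner_def hat_centre_def E
      by (simp add: b1 field_simps)
    moreover have "quadratic_sum b1 b2 b3 c1 c2 c3 = (b1 * c1 + b2 * c2 + b3 * c3) ^ 2"
      unfolding quadratic_sum_def quadratic_edge_def quadratic_inner_def E
      by (simp add: b1 field_simps power2_eq_square)
    moreover have "cubic_sum b1 b2 b3 c1 c2 c3 = (b1 * c1 + b2 * c2 + b3 * c3) ^ 3"
      unfolding cubic_sum_def cubic_edge_def cubic_inner_def cubic_centre_def dbl E
      by (simp add: b1 field_simps power2_eq_square power3_eq_cube)
    ultimately show ?thesis by blast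
  next
    case False
    then have m: "max 0 (2 * b1 - 1) = 2 * b1 - 1" "max 0 (b2 + b3 - b1) = 0"
      and l: "(b1 \<le> b2 + b3) = False" using s by auto
    \<comment> \<open>Here \<open>b1 - b2 - (2 * b1 - 1) = 1 - b1 - b2 = b3\<close>.\<close>
    have "max 0 (b1 - b2 - (2 * b1 - 1)) = b3" "max 0 (b2 - b1 - 0) = 0" "max 0 (b3 - b1 - 0) = 0"
      using o s by auto
    note E = mm corner diff abs sum m this le l if_True if_False
    have "linear_sum b1 b2 b3 c1 c2 c3 = b1 * c1 + b2 * c2 + b3 * c3"
      unfolding linear_sum_def hat_edge_def hat_inner_def hat_centre_def E
      by (simp add: b1 field_simps)
    moreover have "quadratic_sum b1 b2 b3 c1 c2 c3 = (b1 * c1 + b2 * c2 + b3 * c3) ^ 2"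
      unfolding quadratic_sum_def quadratic_edge_def quadratic_inner_def E
      by (simp add: b1 field_simps power2_eq_square)
    moreover have "cubic_sum b1 b2 b3 c1 c2 c3 = (b1 * c1 + b2 * c2 + b3 * c3) ^ 3"
      unfolding cubic_sum_def cubic_edge_def cubic_inner_def cubic_centre_def dbl E
      by (simp add: b1 field_simps power2_eq_square power3_eq_cube)
    ultimately show ?thesis by blast
  qed
  then show "linear_sum b1 b2 b3 c1 c2 c3 = b1 * c1 + b2 * c2 + b3 * c3"
    "quadratic_sum b1 b2 b3 c1 c2 c3 = (b1 * c1 + b2 * c2 + b3 * c3) ^ 2"
    "cubic_sum b1 b2 b3 c1 c2 c3 = (b1 * c1 + b2 * c2 + b3 * c3) ^ 3"
    by blast+
qed

text \<open>Sorting by transpositions: the largest coordinate is moved to the front, then the other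
  two are ordered, and each \<open>c\<close> travels with its \<open>b\<close>.\<close>

lemma
  fixes b1 b2 b3 c1 c2 c3 :: real
  assumes s: "b1 + b2 + b3 = 1" and nn: "0 \<le> b1" "0 \<le> b2" "0 \<le> b3"
  shows linear_sum_eq: "linear_sum b1 b2 b3 c1 c2 c3 = b1 * c1 + b2 * c2 + b3 * c3"
    and quadratic_sum_eq: "quadratic_sum b1 b2 b3 c1 c2 c3 = (b1 * c1 + b2 * c2 + b3 * c3) ^ 2"
    and cubic_sum_eq: "cubic_sum b1 b2 b3 c1 c2 c3 = (b1 * c1 + b2 * c2 + b3 * c3) ^ 3"
proof -
  let ?P = "\<lambda>b1 b2 b3 c1 c2 c3. linear_sum b1 b2 b3 c1 c2 c3 = b1 * c1 + b2 * c2 + b3 * c3 \<and>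
    quadratic_sum b1 b2 b3 c1 c2 c3 = (b1 * c1 + b2 * c2 + b3 * c3) ^ 2 \<and>
    cubic_sum b1 b2 b3 c1 c2 c3 = (b1 * c1 + b2 * c2 + b3 * c3) ^ 3"
  note sorted = linear_sum_sorted quadratic_sum_sorted cubic_sum_sorted
  have swap1: "?P a b c x y z \<longleftrightarrow> ?P b a c y x z" for a b c x y z
    unfolding linear_sum_commute(1)[of b a c y x z] quadratic_sum_commute(1)[of b a c y x z]
      cubic_sum_commute(1)[of b a c y x z]
    by (simp add: ac_simps)
  have swap2: "?P a b c x y z \<longleftrightarrow> ?P a c b x z y" for a b c x y z
    unfolding linear_sum_commute(2)[of a c b x z y] quadratic_sum_commute(2)[of a c b x z y]
      cubic_sum_commute(2)[of a c b x z y]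
    by (simp add: ac_simps)
  have sort2: "?P a b c x y z" if "b \<le> a" "c \<le> a" "a + b + c = 1" "0 \<le> b" "0 \<le> c" for a b c x y z
  proof (cases "c \<le> b")
    case True
    then show ?thesis using that sorted by blast
  next
    case False
    then have "?P a c b x z y" using that sorted[of a c b] by (simp add: ac_simps)
    then show ?thesis using swap2 by blast
  qed
  have "?P b1 b2 b3 c1 c2 c3"
  proof -
    consider "b2 \<le> b1" "b3 \<le> b1" | "b1 \<le> b2" "b3 \<le> b2" | "b1 \<le> b3" "b2 \<le> b3" by linarith
    then show ?thesis
    proof cases
      case 1
      then show ?thesis using sort2 s nn by blast
    next
      case 2
      then have "?P b2 b1 b3 c2 c1 c3" using sort2[of b1 b2 b3 c2 c1 c3] s nn
          by (simp add: ac_simps)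
      then show ?thesis using swap1 by blast
    next
      case 3
      then have "?P b3 b1 b2 c3 c1 c2" using sort2[of b1 b3 b2 c3 c1 c2] s nn
          by (simp add: ac_simps)
      then have "?P b1 b3 b2 c1 c3 c2" using swap1 by blast
      then show ?thesis using swap2 by blast
    qed
  qed
  then show "linear_sum b1 b2 b3 c1 c2 c3 = b1 * c1 + b2 * c2 + b3 * c3"
    "quadratic_sum b1 b2 b3 c1 c2 c3 = (b1 * c1 + b2 * c2 + b3 * c3) ^ 2"
    "cubic_sum b1 b2 b3 c1 c2 c3 = (b1 * c1 + b2 * c2 + b3 * c3) ^ 3"
    by blast+
qed

section \<open>The Marsden identity\<close>

text \<open>Such reflections exchange truncations of \<open>u\<close> and of \<open>- u\<close>;
  they bridge the gap between the formulas found by slicing and the symmetric ones.\<close>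

lemma max0_uminus_power2: "max 0 (- u) ^ 2 = u ^ 2 - max 0 (u::real) ^ 2"
  by (simp add: max_def)

lemma max0_uminus_power3: "max 0 (- u) ^ 3 = max 0 (u::real) ^ 3 - u ^ 3"
  by (simp add: max_def)

lemma abs_power3_eq: "\<bar>u\<bar> ^ 3 = 2 * max 0 (u::real) ^ 3 - u ^ 3"
  by (simp add: max_def abs_if)

context barycentric_triangle
begin

lemma spline2_inner_symmetric:
  "simplex_spline TYPE(real^2) area {#P, Q, midpoint P R, midpoint Q R, midpoint P Q#} x =
    4 * quadratic_inner b1 b2 b3"
proof -
  have "max 0 (b2 - b1 - b3) ^ 2 = (b1 + b3 - b2) ^ 2 - max 0 (b1 + b3 - b2) ^ 2"
    using max0_uminus_power2[of "b1 + b3 - b2"] by (simp add: algebra_simps)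
  moreover have "max 0 (b3 - b1) ^ 2 = (b1 - b3) ^ 2 - max 0 (b1 - b3) ^ 2"
    using max0_uminus_power2[of "b1 - b3"] by simp
  ultimately show ?thesis
    unfolding spline2_inner quadratic_inner_def by (simp add: power2_eq_square algebra_simps)
qed

lemma spline3_centre_symmetric:
  assumes "b2 \<le> b3"
  shows "simplex_spline TYPE(real^3) area {#P, Q, R, midpoint Q R, midpoint P Q, midpoint P R#} x =
    4 * cubic_centre b1 b2 b3"
proof -
  have 1: "max 0 (b1 - b2 - b3) ^ 3 = max 0 (b2 + b3 - b1) ^ 3 + (b1 - b2 - b3) ^ 3"
    using max0_uminus_power3[of "b2 + b3 - b1"] by (simp add: power3_eq_cube algebra_simps)
  have 2: "max 0 (b1 + b3 - b2) = b1 + b3 - b2" "\<bar>b2 - b3\<bar> = b3 - b2"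
    using assms b_nonneg by auto
  have 3: "\<bar>b3 - b1\<bar> ^ 3 = 2 * max 0 (b1 - b3) ^ 3 - (b1 - b3) ^ 3"
    using abs_power3_eq[of "b1 - b3"] by (simp add: abs_minus_commute)
  show ?thesis
    unfolding spline3_centre[OF assms] cubic_centre_def 1 2 3 abs_power3_eq[of "b1 - b2"]
    by (simp add: power2_eq_square power3_eq_cube algebra_simps)
qed

end

section \<open>The three bases on the 12-split\<close>

lemma split12_simps:
  "split12 p1 p2 p3 1 = p1" "split12 p1 p2 p3 2 = p2" "split12 p1 p2 p3 3 = p3"
  "split12 p1 p2 p3 4 = midpoint p1 p2" "split12 p1 p2 p3 5 = midpoint p2 p3"
  "split12 p1 p2 p3 6 = midpoint p1 p3" "split12 p1 p2 p3 7 =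
      midpoint (midpoint p1 p2) (midpoint p1 p3)"
  "split12 p1 p2 p3 8 = midpoint (midpoint p1 p2) (midpoint p2 p3)"
  "split12 p1 p2 p3 9 = midpoint (midpoint p2 p3) (midpoint p1 p3)"
  "split12 p1 p2 p3 10 = (1/3) *\<^sub>R (p1 + p2 + p3)"
  by (simp_all add: split12_def midpoint_sym)

lemma knots_split12:
  "knots (split12 p1 p2 p3) [i, j, k, l, m, n] r = replicate_mset i p1 + replicate_mset j p2 +
    replicate_mset k p3 + replicate_mset l (midpoint p1 p2) + replicate_mset m (midpoint p2 p3) +
    replicate_mset n (midpoint p1 p3) + replicate_mset r ((1/3) *\<^sub>R (p1 + p2 + p3))"
proof -
  have "{..<6} = {0, 1, 2, 3, 4, 5::nat}" by auto
  then show ?thesis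
    using split12_simps[of p1 p2 p3] by (simp add: knots_def add_ac numeral_2_eq_2[symmetric])
qed

lemma sum_indexed_eq_list_dot:
  assumes "length u = n" "length v = n"
  shows "(\<Sum>j = 1..n. u ! (j - 1) * v ! (j - 1)) = list_dot u v"
proof -
  have "(\<Sum>j = 1..n. u ! (j - 1) * v ! (j - 1)) = (\<Sum>j<n. u ! j * v ! j)"
    by (rule sum.reindex_bij_witness[of _ Suc "\<lambda>j. j - 1"]) auto
  then show ?thesis
    using assms by (simp add: list_dot_def sum_list_sum_nth atLeast0LessThan)
qed

lemma sum_half_open_split:
  assumes "half_open_split p T" "x \<in> full_triangle p"
  shows "(\<Sum>j = 1..12. indicat_real (T j) x) = 1"
proof -
  have disj: "disjoint_family_on T {1..12}" and "x \<in> (\<Union>k\<in>{1..12}. T k)"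
    using assms unfolding half_open_split_def by auto
  then obtain k where k: "k \<in> {1..12}" "x \<in> T k" by blast
  have "x \<in> T j \<longleftrightarrow> j = k" if "j \<in> {1..12}" for j
    using k that disjoint_family_onD[OF disj that k(1)] by blast
  then have "(\<Sum>j = 1..12. indicat_real (T j) x) = (\<Sum>j = 1..12. if j = k then 1 else 0)"
    by (intro sum.cong) (auto simp: indicator_def)
  then show ?thesis using k by simp
qed

lemma replicate_mset_simps:
  "replicate_mset 1 a = {#a#}" "replicate_mset 2 a = {#a, a#}" "replicate_mset 3 a = {#a, a, a#}"
  "replicate_mset 4 a = {#a, a, a, a#}"
  by (simp_all add: numeral_eq_Suc)

text \<open>The twelve spline formulas of the locale cover all 38 basis functions; the six
  interpretations, one for each order of the vertices, carry them to the individual splines.\<close>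

lemma
  assumes nc: "\<not> collinear {p1, p2, p3}"
    and x: "x = b1 *\<^sub>R p1 + b2 *\<^sub>R p2 + b3 *\<^sub>R p3" "b1 + b2 + b3 = 1" "0 \<le> b1" "0 \<le> b2" "0 \<le> b3"
  shows s1_split12: "s1 (split12 p1 p2 p3) x = [max 0 (2 * b1 - 1), max 0 (2 * b2 - 1),
      max 0 (2 * b3 - 1), 2 * hat_edge b1 b2 b3, 2 * hat_edge b2 b3 b1, 2 * hat_edge b1 b3 b2,
      4 * hat_inner b1 b2 b3, 4 * hat_inner b2 b1 b3, 4 * hat_inner b3 b1 b2,
      3 * hat_centre b1 b2 b3]" (is ?s1)
    and s2_split12: "s2 (split12 p1 p2 p3) x = [max 0 (2 * b1 - 1) ^ 2,
        2 * quadratic_edge b1 b2 b3, 3 * quadratic_inner b1 b2 b3, 2 * quadratic_edge b2 b1 b3,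
        max 0 (2 * b2 - 1) ^ 2, 2 * quadratic_edge b2 b3 b1, 3 * quadratic_inner b2 b3 b1,
        2 * quadratic_edge b3 b2 b1, max 0 (2 * b3 - 1) ^ 2, 2 * quadratic_edge b3 b1 b2,
        3 * quadratic_inner b1 b3 b2, 2 * quadratic_edge b1 b3 b2]" (is ?s2)
    and s3_split12: "s3 (split12 p1 p2 p3) x = [max 0 (2 * b1 - 1) ^ 3, 2 * cubic_edge b1 b2 b3,
        2 * cubic_double b1 b2, 2 * cubic_edge b2 b1 b3, max 0 (2 * b2 - 1) ^ 3,
        2 * cubic_edge b2 b3 b1, 2 * cubic_double b2 b3, 2 * cubic_edge b3 b2 b1,
        max 0 (2 * b3 - 1) ^ 3, 2 * cubic_edge b3 b1 b2, 2 * cubic_double b1 b3,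
        2 * cubic_edge b1 b3 b2, 4 * cubic_inner b1 b2 b3, 4 * cubic_inner b2 b1 b3,
        4 * cubic_inner b3 b1 b2, cubic_centre b1 b2 b3]" (is ?s3)
proof -
  interpret t123: barycentric_triangle p1 p2 p3 x b1 b2 b3
    using assms by unfold_locales auto
  interpret t132: barycentric_triangle p1 p3 p2 x b1 b3 b2
    using assms by unfold_locales (auto simp: insert_commute add_ac)
  interpret t213: barycentric_triangle p2 p1 p3 x b2 b1 b3
    using assms by unfold_locales (auto simp: insert_commute add_ac)
  interpret t231: barycentric_triangle p2 p3 p1 x b2 b3 b1
    using assms by unfold_locales (auto simp: insert_commute add_ac)
  interpret t312: barycentric_triangle p3 p1 p2 x b3 b1 b2
    using assms by unfold_locales (auto simp: insert_commute add_ac)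
  interpret t321: barycentric_triangle p3 p2 p1 x b3 b2 b1
    using assms by unfold_locales (auto simp: insert_commute add_ac)
  define p where "p = split12 p1 p2 p3"
  \<comment> \<open>Each interpretation has its own \<open>area\<close> and \<open>centroid\<close>;
    they coincide because neither depends on the order of the vertices.\<close>
  have area: "t132.area = t123.area" "t213.area = t123.area" "t231.area = t123.area"
    "t312.area = t123.area" "t321.area = t123.area"
    unfolding t132.area_def t213.area_def t231.area_def t312.area_def t321.area_def t123.area_def
    by (simp_all add: insert_commute)
  have centroid: "t132.centroid = t123.centroid" "t213.centroid = t123.centroid"
      "t231.centroid = t123.centroid"
    "t312.centroid = t123.centroid" "t321.centroid = t123.centroid"
    unfolding t132.centroid_def t213.centroid_def t231.centroid_def t312.centroid_def
        t321.centroid_def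
      t123.centroid_def
    by (simp_all add: add_ac)
  have knots: "knots p [i, j, k, l, m, n] r = replicate_mset i p1 + replicate_mset j p2 +
    replicate_mset k p3 + replicate_mset l (midpoint p1 p2) + replicate_mset m (midpoint p2 p3) +
    replicate_mset n (midpoint p1 p3) + replicate_mset r t123.centroid" for i j k l m n r
    unfolding p_def knots_split12 t123.centroid_def ..
  have "measure lebesgue (full_triangle p) = t123.area"
    using split12_simps[of p1 p2 p3] by (simp add: full_triangle_def p_def t123.area_def)
  then have Q: "Q1 p e r x = simplex_spline TYPE(real) t123.area (knots p e r) x"
    "Q2 p e x = simplex_spline TYPE(real^2) t123.area (knots p e 0) x"
    "Q3 p e x = simplex_spline TYPE(real^3) t123.area (knots p e 0) x" for e r
    by (simp_all add: Q1_def Q2_def Q3_def)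
  have mid: "midpoint p2 p1 = midpoint p1 p2" "midpoint p3 p1 = midpoint p1 p3"
      "midpoint p3 p2 = midpoint p2 p3"
    by (simp_all add: midpoint_sym)
  \<comment> \<open>\<open>add_mset_commute\<close> works as an ordered rewrite rule that sorts the
    knots, so multisets listed in different orders become identical.\<close>
  note simps = Q knots replicate_mset_simps mid area centroid add_mset_commute
  have v1:
    "1/4 * Q1 p [2,0,0,1,0,1] 0 x = max 0 (2 * b1 - 1)"
    "1/4 * Q1 p [0,2,0,1,1,0] 0 x = max 0 (2 * b2 - 1)"
    "1/4 * Q1 p [0,0,2,0,1,1] 0 x = max 0 (2 * b3 - 1)"
    "1/3 * Q1 p [1,1,0,1,0,0] 1 x = 2 * hat_edge b1 b2 b3"
    "1/3 * Q1 p [0,1,1,0,1,0] 1 x = 2 * hat_edge b2 b3 b1"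
    "1/3 * Q1 p [1,0,1,0,0,1] 1 x = 2 * hat_edge b1 b3 b2"
    "1/3 * Q1 p [1,0,0,1,0,1] 1 x = 4 * hat_inner b1 b2 b3"
    "1/3 * Q1 p [0,1,0,1,1,0] 1 x = 4 * hat_inner b2 b1 b3"
    "1/3 * Q1 p [0,0,1,0,1,1] 1 x = 4 * hat_inner b3 b1 b2"
    "1/4 * Q1 p [0,0,0,1,1,1] 1 x = 3 * hat_centre b1 b2 b3"
    using t123.spline1_corner t213.spline1_corner t312.spline1_corner t123.spline1_edge[folded
        hat_edge_def] t231.spline1_edge[folded hat_edge_def] t132.spline1_edge[folded
        hat_edge_def] t123.spline1_inner[folded hat_inner_def] t213.spline1_inner[folded
        hat_inner_def] t312.spline1_inner[folded hat_inner_def] t123.spline1_centre[folded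
        hat_centre_def]
    by (simp_all add: simps)
  have v2:
    "1/4 * Q2 p [3,0,0,1,0,1] x = max 0 (2 * b1 - 1) ^ 2"
    "1/2 * Q2 p [2,1,0,1,0,1] x = 2 * quadratic_edge b1 b2 b3"
    "3/4 * Q2 p [1,1,0,1,1,1] x = 3 * quadratic_inner b1 b2 b3"
    "1/2 * Q2 p [1,2,0,1,1,0] x = 2 * quadratic_edge b2 b1 b3"
    "1/4 * Q2 p [0,3,0,1,1,0] x = max 0 (2 * b2 - 1) ^ 2"
    "1/2 * Q2 p [0,2,1,1,1,0] x = 2 * quadratic_edge b2 b3 b1"
    "3/4 * Q2 p [0,1,1,1,1,1] x = 3 * quadratic_inner b2 b3 b1"
    "1/2 * Q2 p [0,1,2,0,1,1] x = 2 * quadratic_edge b3 b2 b1"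
    "1/4 * Q2 p [0,0,3,0,1,1] x = max 0 (2 * b3 - 1) ^ 2"
    "1/2 * Q2 p [1,0,2,0,1,1] x = 2 * quadratic_edge b3 b1 b2"
    "3/4 * Q2 p [1,0,1,1,1,1] x = 3 * quadratic_inner b1 b3 b2"
    "1/2 * Q2 p [2,0,1,1,0,1] x = 2 * quadratic_edge b1 b3 b2"
    using t123.spline2_corner t123.spline2_edge[folded quadratic_edge_def]
        t123.spline2_inner_symmetric t213.spline2_edge[folded quadratic_edge_def]
        t213.spline2_corner t231.spline2_edge[folded quadratic_edge_def]
        t231.spline2_inner_symmetric t321.spline2_edge[folded quadratic_edge_def]
        t312.spline2_corner t312.spline2_edge[folded quadratic_edge_def]
        t132.spline2_inner_symmetric t132.spline2_edge[folded quadratic_edge_def]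
    by (simp_all add: simps)
  have v3_1: "1/4 * Q3 p [4,0,0,1,0,1] x = max 0 (2 * b1 - 1) ^ 3"
    using t123.spline3_corner by (simp add: simps)
  have v3_2: "1/2 * Q3 p [3,1,0,1,0,1] x = 2 * cubic_edge b1 b2 b3"
    using t123.spline3_edge[folded cubic_edge_def] by (simp add: simps)
  \<comment> \<open>\<open>spline3_double\<close> presupposes an order of two coordinates, so the
    order of the vertices is chosen to suit the case; the same happens for \<open>v3_7\<close>,
    \<open>v3_11\<close> and \<open>v3_16\<close>.\<close>
  have v3_3: "Q3 p [2,2,1,1,0,0] x = 2 * cubic_double b1 b2"
  proof (cases "b1 \<le> b2")
    case True
    then show ?thesis using t123.spline3_double by (simp add: simps cubic_double_def)
  next
    case False
    then show ?thesis using t213.spline3_double by (simp add: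
        simps cubic_double_def cubic_centre_commute)
  qed
  have v3_4: "1/2 * Q3 p [1,3,0,1,1,0] x = 2 * cubic_edge b2 b1 b3"
    using t213.spline3_edge[folded cubic_edge_def] by (simp add: simps)
  have v3_5: "1/4 * Q3 p [0,4,0,1,1,0] x = max 0 (2 * b2 - 1) ^ 3"
    using t213.spline3_corner by (simp add: simps)
  have v3_6: "1/2 * Q3 p [0,3,1,1,1,0] x = 2 * cubic_edge b2 b3 b1"
    using t231.spline3_edge[folded cubic_edge_def] by (simp add: simps)
  have v3_7: "Q3 p [1,2,2,0,1,0] x = 2 * cubic_double b2 b3"
  proof (cases "b2 \<le> b3")
    case True
    then show ?thesis using t231.spline3_double by (simp add: simps cubic_double_def)
  next
    case False
    then show ?thesis using t321.spline3_double by (simp add: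
        simps cubic_double_def cubic_centre_commute)
  qed
  have v3_8: "1/2 * Q3 p [0,1,3,0,1,1] x = 2 * cubic_edge b3 b2 b1"
    using t321.spline3_edge[folded cubic_edge_def] by (simp add: simps)
  have v3_9: "1/4 * Q3 p [0,0,4,0,1,1] x = max 0 (2 * b3 - 1) ^ 3"
    using t312.spline3_corner by (simp add: simps)
  have v3_10: "1/2 * Q3 p [1,0,3,0,1,1] x = 2 * cubic_edge b3 b1 b2"
    using t312.spline3_edge[folded cubic_edge_def] by (simp add: simps)
  have v3_11: "Q3 p [2,1,2,0,0,1] x = 2 * cubic_double b1 b3"
  proof (cases "b1 \<le> b3")
    case True
    then show ?thesis using t132.spline3_double by (simp add: simps cubic_double_def)
  next
    case False
    then show ?thesis using t312.spline3_double by (simp add: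
        simps cubic_double_def cubic_centre_commute)
  qed
  have v3_12: "1/2 * Q3 p [3,0,1,1,0,1] x = 2 * cubic_edge b1 b3 b2"
    using t132.spline3_edge[folded cubic_edge_def] by (simp add: simps)
  have v3_13: "Q3 p [2,1,1,1,0,1] x = 4 * cubic_inner b1 b2 b3"
    using t123.spline3_inner by (simp add: simps cubic_inner_def diff_diff_add algebra_simps)
  have v3_14: "Q3 p [1,2,1,1,1,0] x = 4 * cubic_inner b2 b1 b3"
    using t213.spline3_inner by (simp add: simps cubic_inner_def diff_diff_add algebra_simps)
  have v3_15: "Q3 p [1,1,2,0,1,1] x = 4 * cubic_inner b3 b1 b2"
    using t312.spline3_inner by (simp add: simps cubic_inner_def diff_diff_add algebra_simps)
  have v3_16: "1/4 * Q3 p [1,1,1,1,1,1] x = cubic_centre b1 b2 b3"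
  proof (cases "b2 \<le> b3")
    case True
    then show ?thesis using t123.spline3_centre_symmetric by (simp add: simps cubic_double_def)
  next
    case False
    then show ?thesis using t132.spline3_centre_symmetric by (simp add:
        simps cubic_double_def cubic_centre_commute)
  qed
  note v3 = v3_1 v3_2 v3_3 v3_4 v3_5 v3_6 v3_7 v3_8 v3_9 v3_10 v3_11 v3_12 v3_13 v3_14 v3_15 v3_16
  show ?s1
    unfolding s1_def p_def[symmetric] v1 ..
  show ?s2
    unfolding s2_def p_def[symmetric] v2 ..
  show ?s3
    unfolding s3_def p_def[symmetric] v3 ..
qed

theorem corollary4p2:
  fixes p1 p2 p3 :: "real^2" and p :: "nat \<Rightarrow> real^2" and T :: "nat \<Rightarrow> (real^2) set"
    and x y :: "real^2" and d :: nat
  assumes nondegenerate: "\<not> collinear {p1, p2, p3}"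
    and p: "p = split12 p1 p2 p3"
    and T: "half_open_split p T"
    and x: "x \<in> convex hull {p1, p2, p3}"
    and d: "d \<in> {0, 1, 2, 3}"
  shows "(1 - x \<bullet> y) ^ d = (\<Sum>j = 1..basis_size d. S p T j d x * dual_poly p j d y) \<and>
    (\<Sum>j = 1..basis_size d. S p T j d x * dual_poly p j d y)
      = list_dot (basis_vec p T d x) (dual_vec p d y)"
proof -
  have len: "length (basis_vec p T d x) = basis_size d" "length (dual_vec p d y) = basis_size d"
    using d by (auto simp: basis_vec_def dual_vec_def basis_size_def s0_def s1_def s2_def s3_def
        Let_def)
  have sum: "(\<Sum>j = 1..basis_size d. S p T j d x * dual_poly p j d y)
      = list_dot (basis_vec p T d x) (dual_vec p d y)"
    unfolding S_def dual_poly_def by (rule sum_indexed_eq_list_dot[OF len])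
  obtain b1 b2 b3 where b: "0 \<le> b1" "0 \<le> b2" "0 \<le> b3" "b1 + b2 + b3 = 1"
    and xb: "x = b1 *\<^sub>R p1 + b2 *\<^sub>R p2 + b3 *\<^sub>R p3"
    using x unfolding convex_hull_3 by blast
  note lists = s1_split12[OF nondegenerate xb b(4,1-3)] s2_split12[OF nondegenerate xb b(4,1-3)]
    s3_split12[OF nondegenerate xb b(4,1-3)]
  define c1 c2 c3 where "c1 = 1 - p1 \<bullet> y" and "c2 = 1 - p2 \<bullet> y" and "c3 = 1 - p3 \<bullet> y"
  have mid: "1 - midpoint u v \<bullet> y = ((1 - u \<bullet> y) + (1 - v \<bullet> y)) / 2" for u v :: "real^2"
    by (simp add: midpoint_eq inner_add_left field_simps)
  have cen: "1 - ((1/3) *\<^sub>R (p1 + p2 + p3)) \<bullet> y = (c1 + c2 + c3) / 3"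
    by (simp add: c1_def c2_def c3_def inner_add_left field_simps)
  have c: "1 - p 1 \<bullet> y = c1" "1 - p 2 \<bullet> y = c2" "1 - p 3 \<bullet> y = c3" "1 - p 4 \<bullet> y = (c1 + c2) / 2"
    "1 - p 5 \<bullet> y = (c2 + c3) / 2" "1 - p 6 \<bullet> y = (c1 + c3) / 2"
    "1 - p 7 \<bullet> y = ((c1 + c2) / 2 + (c1 + c3) / 2) / 2"
        "1 - p 8 \<bullet> y = ((c1 + c2) / 2 + (c2 + c3) / 2) / 2"
    "1 - p 9 \<bullet> y = ((c2 + c3) / 2 + (c1 + c3) / 2) / 2" "1 - p 10 \<bullet> y = (c1 + c2 + c3) / 3"
    unfolding p split12_simps mid cen by (simp_all add: c1_def c2_def c3_def)
  \<comment> \<open>As the weights sum to \<open>1\<close>, the affine function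
    \<open>1 - p \<bullet> y\<close> takes at \<open>x\<close> the same combination of its vertex
    values.\<close>
  have "1 - x \<bullet> y = (b1 + b2 + b3) - x \<bullet> y" using b by simp
  then have xy: "1 - x \<bullet> y = b1 * c1 + b2 * c2 + b3 * c3"
    by (simp add: xb c1_def c2_def c3_def inner_add_left algebra_simps)
  consider "d = 0" | "d = 1" | "d = 2" | "d = 3" using d by auto
  then have "(1 - x \<bullet> y) ^ d = list_dot (basis_vec p T d x) (dual_vec p d y)"
  proof cases
    case 1
    \<comment> \<open>For \<open>d = 0\<close> all dual polynomials are \<open>1\<close>, so the sum
      counts the half-open subtriangles containing \<open>x\<close>, and there is exactly
      one.\<close>
    have "x \<in> full_triangle p"
      using x split12_simps[of p1 p2 p3] by (simp add: full_triangle_def p)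
    have "(\<Sum>j = 1..basis_size d. S p T j d x * dual_poly p j d y) = (\<Sum>j = 1..12.
        indicat_real (T j) x)"
      unfolding 1
      by (rule sum.cong)
        (auto simp: S_def dual_poly_def basis_vec_def dual_vec_def basis_size_def s0_def Let_def)
    then show ?thesis
      using sum_half_open_split[OF T \<open>x \<in> full_triangle p\<close>] sum by (simp add: 1)
  next
    case 2
    have u: "[1..<11] = [1, 2, 3, 4, 5, 6, 7, 8, 9, 10::nat]" by code_simp
    have "dual_vec p d y = [c1, c2, c3, (c1 + c2) / 2, (c2 + c3) / 2, (c1 + c3) / 2,
      ((c1 + c2) / 2 + (c1 + c3) / 2) / 2, ((c1 + c2) / 2 + (c2 + c3) / 2) / 2,
      ((c2 + c3) / 2 + (c1 + c3) / 2) / 2, (c1 + c2 + c3) / 3]"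
      unfolding 2 dual_vec_def Let_def u list.map c by simp
    moreover have "basis_vec p T d x = s1 p x" by (simp add: 2 basis_vec_def)
    ultimately have "list_dot (basis_vec p T d x) (dual_vec p d y) = linear_sum b1 b2 b3 c1 c2 c3"
      unfolding p lists by (simp add: list_dot_def linear_sum_def ac_simps)
    then show ?thesis using linear_sum_eq[OF b(4,1-3)] by (simp add: 2 xy)
  next
    case 3
    have "dual_vec p d y = [c1 ^ 2, c1 * ((c1 + c2) / 2), ((c1 + c2) / 2) * ((c1 + c2 + c3) / 3),
        c2 * ((c1 + c2) / 2), c2 ^ 2, c2 * ((c2 + c3) / 2),
        ((c2 + c3) / 2) * ((c1 + c2 + c3) / 3), c3 * ((c2 + c3) / 2), c3 ^ 2,
        c3 * ((c1 + c3) / 2), ((c1 + c3) / 2) * ((c1 + c2 + c3) / 3), c1 * ((c1 + c3) / 2)]"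
      unfolding 3 dual_vec_def Let_def c by simp
    moreover have "basis_vec p T d x = s2 p x" by (simp add: 3 basis_vec_def)
    ultimately have "list_dot (basis_vec p T d x) (dual_vec p d y) =
        quadratic_sum b1 b2 b3 c1 c2 c3"
      unfolding p lists by (simp add: list_dot_def quadratic_sum_def ac_simps)
    then show ?thesis using quadratic_sum_eq[OF b(4,1-3)] by (simp add: 3 xy)
  next
    case 4
    have "dual_vec p d y = [c1 ^ 3, c1 ^ 2 * ((c1 + c2) / 2), c1 * c2 * ((c1 + c2) / 2),
        c2 ^ 2 * ((c1 + c2) / 2), c2 ^ 3, c2 ^ 2 * ((c2 + c3) / 2), c2 * c3 * ((c2 + c3) / 2),
        c3 ^ 2 * ((c2 + c3) / 2), c3 ^ 3, c3 ^ 2 * ((c1 + c3) / 2), c1 * c3 * ((c1 + c3) / 2),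
        c1 ^ 2 * ((c1 + c3) / 2), c1 * ((c1 + c2) / 2) * ((c1 + c3) / 2),
        c2 * ((c1 + c2) / 2) * ((c2 + c3) / 2), c3 * ((c2 + c3) / 2) * ((c1 + c3) / 2),
        c1 * c2 * c3]"
      unfolding 4 dual_vec_def Let_def c by simp
    moreover have "basis_vec p T d x = s3 p x" by (simp add: 4 basis_vec_def)
    ultimately have "list_dot (basis_vec p T d x) (dual_vec p d y) = cubic_sum b1 b2 b3 c1 c2 c3"
      unfolding p lists by (simp add: list_dot_def cubic_sum_def ac_simps)
    then show ?thesis using cubic_sum_eq[OF b(4,1-3)] by (simp add: 4 xy)
  qed
  with sum show ?thesis by simp
qed

end
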